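(* Let $n>1$ be an integer and let $p_1,p_2,\dots,p_n$ be distinct primes. There exist positive integers $l_1,\dots,l_n$, depending only on $p_1,\dots,p_n$, such that for every $n$-tuple of integers $m_1\ge l_1,\ m_2\ge l_2,\dots,\ m_n\ge l_n$ there exists a simple left brace of order $p_1^{m_1}p_2^{m_2}\cdots p_n^{m_n}$ whose multiplicative group is metabelian and has all its Sylow subgroups abelian.
   Context: A left brace is a set $B$ with two binary operations $+$ and $\cdot$ such that $(B,+)$ is an abelian group, $(B,\cdot)$ is a group, and $a\cdot(b+c)+a=a\cdot b+a\cdot c$ for all $a,b,c\in B$. For $a,b\in B$ put $\lambda_a(b)=ab-a$; then $\lambda_a\in\mathrm{Aut}(B,+)$. A left ideal of $B$ is a subgroup $L$ of $(B,+)$ with $\lambda_b(L)\subseteq L$ for all $b\in B$; an ideal is a left ideal that is also a normal subgroup of $(B,\cdot)$. A left brace $B$ is simple if $B\neq 0$ and its only ideals are $0$ and $B$. The order of $B$ is $|B|$. A group is metabelian if its derived length is at most $2$. *)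

theory Defs
  imports "HOL-Algebra.Algebra" "HOL-Computational_Algebra.Primes"
begin

text \<open>A left brace: additive structure A (abelian group) and multiplicative
structure M (group) on the same carrier, with the brace compatibility law
a(b+c) + a = ab + ac.  The additive group operation is the "mult" of A.\<close>

definition left_brace :: "('a, 'b) monoid_scheme \<Rightarrow> ('a, 'c) monoid_scheme \<Rightarrow> bool" where
  "left_brace A M \<longleftrightarrow> comm_group A \<and> group M \<and> carrier A = carrier M \<and>
     (\<forall>a\<in>carrier M. \<forall>b\<in>carrier M. \<forall>c\<in>carrier M.
        (a \<otimes>\<^bsub>M\<^esub> (b \<otimes>\<^bsub>A\<^esub> c)) \<otimes>\<^bsub>A\<^esub> a
          = (a \<otimes>\<^bsub>M\<^esub> b) \<otimes>\<^bsub>A\<^esub> (a \<otimes>\<^bsub>M\<^esub> c))"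

definition brace_lambda :: "('a, 'b) monoid_scheme \<Rightarrow> ('a, 'c) monoid_scheme \<Rightarrow> 'a \<Rightarrow> 'a \<Rightarrow> 'a" where
  "brace_lambda A M a b = (a \<otimes>\<^bsub>M\<^esub> b) \<otimes>\<^bsub>A\<^esub> inv\<^bsub>A\<^esub> a"

definition brace_left_ideal :: "('a, 'b) monoid_scheme \<Rightarrow> ('a, 'c) monoid_scheme \<Rightarrow> 'a set \<Rightarrow> bool" where
  "brace_left_ideal A M L \<longleftrightarrow> subgroup L A \<and>
     (\<forall>b\<in>carrier M. \<forall>x\<in>L. brace_lambda A M b x \<in> L)"

definition brace_ideal :: "('a, 'b) monoid_scheme \<Rightarrow> ('a, 'c) monoid_scheme \<Rightarrow> 'a set \<Rightarrow> bool" where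
  "brace_ideal A M I \<longleftrightarrow> brace_left_ideal A M I \<and> I \<lhd> M"

definition simple_left_brace :: "('a, 'b) monoid_scheme \<Rightarrow> ('a, 'c) monoid_scheme \<Rightarrow> bool" where
  "simple_left_brace A M \<longleftrightarrow> left_brace A M \<and> carrier A \<noteq> {\<one>\<^bsub>A\<^esub>} \<and>
     (\<forall>I. brace_ideal A M I \<longrightarrow> I = {\<one>\<^bsub>A\<^esub>} \<or> I = carrier A)"

definition metabelian :: "('a, 'b) monoid_scheme \<Rightarrow> bool" where
  "metabelian G \<longleftrightarrow> derived G (derived G (carrier G)) = {\<one>\<^bsub>G\<^esub>}"

definition sylow_subgroup :: "('a, 'b) monoid_scheme \<Rightarrow> nat \<Rightarrow> 'a set \<Rightarrow> bool" where
  "sylow_subgroup G p P \<longleftrightarrow> Factorial_Ring.prime p \<and> subgroup P G \<and>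
     card P = p ^ multiplicity p (order G)"

definition all_sylow_abelian :: "('a, 'b) monoid_scheme \<Rightarrow> bool" where
  "all_sylow_abelian G \<longleftrightarrow>
     (\<forall>p P. sylow_subgroup G p P \<longrightarrow> comm_group (G\<lparr>carrier := P\<rparr>))"

end

theory Submission
  imports Defs
begin

text \<open>
Let $E$ act on an abelian group $U$ and let $b : U \times U \to E$ be a symmetric biadditive form
invariant under the action. Then $(u,e)(v,f) = (u + e v, e + f)$ and
$(u,e)+(v,f) = (u+v, e+f+b(u,v))$ make $U \times E$ a left brace whose multiplicative group is the
semidirect product. For an ideal $I$ put $J = I \cap E$: if $(u,e) \in I$ then $b(u,v) \in J$ for
all $v$, and if $e \in J$ then $(e v - v, e) \in I$ for all $v$.

Such data come from a finite digraph with vertices labelled by primes, the two ends of each arc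
carrying distinct labels. Each vertex $a$ contributes $\mathbb{Z}/\pi(a)$ to $E$; each arc
$a \to a'$ contributes to $U$ the functions $\mathbb{Z}/\pi(a) \to \mathbb{Z}/\pi(a')$ of sum
zero, on which the $a$-component of $E$ acts by cyclic shift, and whose dot product feeds the
$a'$-component of $b$. A nonzero ideal propagates along the arcs, so strong connectivity gives
simplicity. The order is the product of $\pi(a)$ over all vertices and of
$\pi(a')^{\pi(a)-1}$ over all arcs.

Taking $k_i$ vertices labelled $p_i$ and $r_i$ arcs from label $p_{i-1}$ to label $p_i$, indices
modulo $n$, the exponent of $p_i$ is $k_i + r_i (p_{i-1} - 1)$; with
$1 \le k_i \le p_{i-1} - 1$ this represents every large integer.
\<close>

subsection \<open>Braces from invariant symmetric forms\<close>

locale invariant_form = U: comm_group U + E: comm_group E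
  for U :: "('u, 'x) monoid_scheme" (structure) and E :: "('e, 'y) monoid_scheme" (structure) +
  fixes act :: "'e \<Rightarrow> 'u \<Rightarrow> 'u" and b :: "'u \<Rightarrow> 'u \<Rightarrow> 'e"
  assumes act_closed [simp, intro]:
      "\<lbrakk>e \<in> carrier E; u \<in> carrier U\<rbrakk> \<Longrightarrow> act e u \<in> carrier U"
    and act_mult: "\<lbrakk>e \<in> carrier E; u \<in> carrier U; v \<in> carrier U\<rbrakk>
      \<Longrightarrow> act e (u \<otimes>\<^bsub>U\<^esub> v) = act e u \<otimes>\<^bsub>U\<^esub> act e v"
    and act_comp: "\<lbrakk>e \<in> carrier E; f \<in> carrier E; u \<in> carrier U\<rbrakk>
      \<Longrightarrow> act (e \<otimes>\<^bsub>E\<^esub> f) u = act e (act f u)"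
    and act_one: "u \<in> carrier U \<Longrightarrow> act \<one>\<^bsub>E\<^esub> u = u"
    and form_closed [simp, intro]:
      "\<lbrakk>u \<in> carrier U; v \<in> carrier U\<rbrakk> \<Longrightarrow> b u v \<in> carrier E"
    and form_mult_left: "\<lbrakk>u \<in> carrier U; v \<in> carrier U; w \<in> carrier U\<rbrakk>
      \<Longrightarrow> b (u \<otimes>\<^bsub>U\<^esub> v) w = b u w \<otimes>\<^bsub>E\<^esub> b v w"
    and form_commute: "\<lbrakk>u \<in> carrier U; v \<in> carrier U\<rbrakk> \<Longrightarrow> b u v = b v u"
    and form_act: "\<lbrakk>e \<in> carrier E; u \<in> carrier U; v \<in> carrier U\<rbrakk>
      \<Longrightarrow> b (act e u) (act e v) = b u v"
begin

section \<open>Calculus of the form and of the action\<close>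

lemma form_mult_right: "\<lbrakk>u \<in> carrier U; v \<in> carrier U; w \<in> carrier U\<rbrakk>
      \<Longrightarrow> b w (u \<otimes>\<^bsub>U\<^esub> v) = b w u \<otimes>\<^bsub>E\<^esub> b w v"
  by (metis form_commute form_mult_left U.m_closed)

lemma form_one_left [simp]: "u \<in> carrier U \<Longrightarrow> b \<one>\<^bsub>U\<^esub> u = \<one>\<^bsub>E\<^esub>"
  using form_mult_left[of "\<one>\<^bsub>U\<^esub>" "\<one>\<^bsub>U\<^esub>" u] by (simp add: E.r_cancel_one')

lemma form_one_right [simp]: "u \<in> carrier U \<Longrightarrow> b u \<one>\<^bsub>U\<^esub> = \<one>\<^bsub>E\<^esub>"
  by (metis form_commute form_one_left U.one_closed)

lemma form_inv_left [simp]: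
  assumes "u \<in> carrier U" "v \<in> carrier U"
  shows "b (inv\<^bsub>U\<^esub> u) v = inv\<^bsub>E\<^esub> (b u v)"
proof -
  have "b (inv\<^bsub>U\<^esub> u) v \<otimes>\<^bsub>E\<^esub> b u v = \<one>\<^bsub>E\<^esub>"
    using assms by (simp flip: form_mult_left)
  then show ?thesis using assms by (intro E.inv_equality[symmetric]) auto
qed

lemma form_inv_right [simp]:
  "\<lbrakk>u \<in> carrier U; v \<in> carrier U\<rbrakk> \<Longrightarrow> b u (inv\<^bsub>U\<^esub> v) = inv\<^bsub>E\<^esub> (b u v)"
  by (metis form_commute form_inv_left U.inv_closed)

lemma act_to_one [simp]: "e \<in> carrier E \<Longrightarrow> act e \<one>\<^bsub>U\<^esub> = \<one>\<^bsub>U\<^esub>"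
  using act_mult[of e "\<one>\<^bsub>U\<^esub>" "\<one>\<^bsub>U\<^esub>"] by (simp add: U.r_cancel_one')

text \<open>This is an extension of \<open>U\<close> by \<open>E\<close> with 2-cocycle
  \<open>b\<close>: biadditivity yields the cocycle identity, symmetry makes the extension
  abelian.\<close>

definition add_group :: "('u \<times> 'e) monoid" where
  "add_group = \<lparr>carrier = carrier U \<times> carrier E,
     monoid.mult = (\<lambda>(u, e) (v, f). (u \<otimes>\<^bsub>U\<^esub> v, e \<otimes>\<^bsub>E\<^esub> f \<otimes>\<^bsub>E\<^esub> b u v)),
     one = (\<one>\<^bsub>U\<^esub>, \<one>\<^bsub>E\<^esub>)\<rparr>"

definition mult_group :: "('u \<times> 'e) monoid" where
  "mult_group = \<lparr>carrier = carrier U \<times> carrier E,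
     monoid.mult = (\<lambda>(u, e) (v, f). (u \<otimes>\<^bsub>U\<^esub> act e v, e \<otimes>\<^bsub>E\<^esub> f)),
     one = (\<one>\<^bsub>U\<^esub>, \<one>\<^bsub>E\<^esub>)\<rparr>"

lemma add_group_simps [simp]:
  "carrier add_group = carrier U \<times> carrier E"
  "(u, e) \<otimes>\<^bsub>add_group\<^esub> (v, f) = (u \<otimes>\<^bsub>U\<^esub> v, e \<otimes>\<^bsub>E\<^esub> f \<otimes>\<^bsub>E\<^esub> b u v)"
  "\<one>\<^bsub>add_group\<^esub> = (\<one>\<^bsub>U\<^esub>, \<one>\<^bsub>E\<^esub>)"
  by (simp_all add: add_group_def)

lemma mult_group_simps [simp]:
  "carrier mult_group = carrier U \<times> carrier E"
  "(u, e) \<otimes>\<^bsub>mult_group\<^esub> (v, f) = (u \<otimes>\<^bsub>U\<^esub> act e v, e \<otimes>\<^bsub>E\<^esub> f)"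
  "\<one>\<^bsub>mult_group\<^esub> = (\<one>\<^bsub>U\<^esub>, \<one>\<^bsub>E\<^esub>)"
  by (simp_all add: mult_group_def)

text \<open>The correction \<open>b u u\<close> cancels the cocycle value at (-u, u), which is -b(u,
  u).\<close>

lemma add_group_inv_aux:
  assumes "u \<in> carrier U" "e \<in> carrier E"
  shows "(inv\<^bsub>U\<^esub> u, inv\<^bsub>E\<^esub> e \<otimes>\<^bsub>E\<^esub> b u u) \<otimes>\<^bsub>add_group\<^esub> (u, e) = \<one>\<^bsub>add_group\<^esub>"
proof -
  have "inv\<^bsub>E\<^esub> e \<otimes>\<^bsub>E\<^esub> b u u \<otimes>\<^bsub>E\<^esub> e = b u u"
    using assms by (metis E.inv_solve_left E.m_closed E.m_comm E.m_assoc form_closed E.inv_closed)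
  then show ?thesis using assms by (simp add: E.r_inv)
qed

lemma comm_group_add_group: "comm_group add_group"
proof (rule comm_groupI)
  fix x assume "x \<in> carrier add_group"
  then show "\<exists>y\<in>carrier add_group. y \<otimes>\<^bsub>add_group\<^esub> x = \<one>\<^bsub>add_group\<^esub>"
    using add_group_inv_aux
    by (intro bexI[of _ "(inv\<^bsub>U\<^esub> (fst x), inv\<^bsub>E\<^esub> (snd x) \<otimes>\<^bsub>E\<^esub> b (fst x) (fst x))"]) auto
qed (auto simp: U.m_ac E.m_ac form_mult_left form_mult_right form_commute)

lemma group_mult_group: "group mult_group"
proof (rule groupI)
  fix x assume "x \<in> carrier mult_group"
  then show "\<exists>y\<in>carrier mult_group. y \<otimes>\<^bsub>mult_group\<^esub> x = \<one>\<^bsub>mult_group\<^esub>"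
    by (intro bexI[of _ "(act (inv\<^bsub>E\<^esub> (snd x)) (inv\<^bsub>U\<^esub> (fst x)), inv\<^bsub>E\<^esub> (snd x))"])
       (auto simp flip: act_mult)
qed (auto simp: U.m_assoc E.m_assoc act_mult act_comp act_one)

sublocale add: comm_group add_group by (rule comm_group_add_group)
sublocale mul: group mult_group by (rule group_mult_group)

lemma add_group_inv:
  assumes "u \<in> carrier U" "e \<in> carrier E"
  shows "inv\<^bsub>add_group\<^esub> (u, e) = (inv\<^bsub>U\<^esub> u, inv\<^bsub>E\<^esub> e \<otimes>\<^bsub>E\<^esub> b u u)"
  using add_group_inv_aux[OF assms] assms by (intro add.inv_equality) auto

lemma mult_group_inv:
  assumes "u \<in> carrier U" "e \<in> carrier E"
  shows "inv\<^bsub>mult_group\<^esub> (u, e) = (act (inv\<^bsub>E\<^esub> e) (inv\<^bsub>U\<^esub> u), inv\<^bsub>E\<^esub> e)"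
  using assms by (intro mul.inv_equality) (auto simp flip: act_mult)

text \<open>After cancelling common terms, the \<open>E\<close>-components of the two sides differ
  only in b(v, w) against b(e v, e w), which agree by invariance, and in b(e w, u) against b(u, e
  w), which agree by symmetry.\<close>

lemma left_brace: "left_brace add_group mult_group"
  unfolding left_brace_def
proof (intro conjI ballI comm_group_add_group group_mult_group)
  fix x y z assume xyz: "x \<in> carrier mult_group" "y \<in> carrier mult_group" "z \<in> carrier mult_group"
  obtain u e v f w g where [simp]: "x = (u, e)" "y = (v, f)" "z = (w, g)"
    by (cases x, cases y, cases z)
  have [simp]: "u \<in> carrier U" "v \<in> carrier U" "w \<in> carrier U"
    "e \<in> carrier E" "f \<in> carrier E" "g \<in> carrier E" using xyz by auto
  have "b (act e w) u = b u (act e w)" by (simp add: form_commute)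
  then show "x \<otimes>\<^bsub>mult_group\<^esub> (y \<otimes>\<^bsub>add_group\<^esub> z) \<otimes>\<^bsub>add_group\<^esub> x =
      x \<otimes>\<^bsub>mult_group\<^esub> y \<otimes>\<^bsub>add_group\<^esub> (x \<otimes>\<^bsub>mult_group\<^esub> z)"
    by (simp add: act_mult form_mult_left form_mult_right form_act U.m_ac E.m_ac)
qed auto

section \<open>Ideals and a criterion for simplicity\<close>

lemma ideal_form_in:
  assumes "brace_ideal add_group mult_group I" "(u, e) \<in> I" "v \<in> carrier U"
  shows "(\<one>\<^bsub>U\<^esub>, b u v) \<in> I"
proof -
  have sub: "subgroup I add_group"
    and lam: "\<And>y x. y \<in> carrier mult_group \<Longrightarrow> x \<in> I \<Longrightarrow> brace_lambda add_group mult_group y x \<in> I"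
    using assms(1) by (auto simp: brace_ideal_def brace_left_ideal_def)
  have ue [simp]: "u \<in> carrier U" "e \<in> carrier E"
    using subgroup.mem_carrier[OF sub assms(2)] by auto
  note [simp] = assms(3)
  \<comment> \<open>The lambda map of (-v, 0) fixes the \<open>U\<close>-component and translates
    the \<open>E\<close>-component by b(u, v); subtracting the original element isolates that
    translation.\<close>
  have "brace_lambda add_group mult_group (inv\<^bsub>U\<^esub> v, \<one>\<^bsub>E\<^esub>) (u, e) =
      (inv\<^bsub>U\<^esub> v \<otimes>\<^bsub>U\<^esub> u, e) \<otimes>\<^bsub>add_group\<^esub> (v, b v v)"
    by (simp add: brace_lambda_def add_group_inv act_one del: add_group_simps(2))
  also have "\<dots> = (u, e \<otimes>\<^bsub>E\<^esub> b u v)"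
    by (simp add: form_mult_left U.m_ac E.m_ac)
  finally have "(u, e \<otimes>\<^bsub>E\<^esub> b u v) \<in> I"
    using lam[of "(inv\<^bsub>U\<^esub> v, \<one>\<^bsub>E\<^esub>)" "(u, e)"] assms(2) by simp
  then have "inv\<^bsub>add_group\<^esub> (u, e) \<otimes>\<^bsub>add_group\<^esub> (u, e \<otimes>\<^bsub>E\<^esub> b u v) \<in> I"
    using sub assms(2) by (simp add: subgroup.m_closed subgroup.m_inv_closed del: add_group_simps(2))
  moreover have "inv\<^bsub>E\<^esub> e \<otimes>\<^bsub>E\<^esub> b u u \<otimes>\<^bsub>E\<^esub> (e \<otimes>\<^bsub>E\<^esub> b u v) \<otimes>\<^bsub>E\<^esub> inv\<^bsub>E\<^esub> (b u u)
      = (inv\<^bsub>E\<^esub> e \<otimes>\<^bsub>E\<^esub> e) \<otimes>\<^bsub>E\<^esub> (b u u \<otimes>\<^bsub>E\<^esub> inv\<^bsub>E\<^esub> (b u u)) \<otimes>\<^bsub>E\<^esub> b u v"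
    by (simp only: E.m_ac ue E.inv_closed form_closed E.m_closed assms(3))
  ultimately show ?thesis by (simp add: add_group_inv)
qed

text \<open>Conjugating (0, e) by (-v, 0) in the semidirect product leaves \<open>e\<close> in place
  and creates the displacement e v - v. Normality of the ideal enters only here.\<close>

lemma ideal_act_in:
  assumes "brace_ideal add_group mult_group I" "(\<one>\<^bsub>U\<^esub>, e) \<in> I" "v \<in> carrier U"
  shows "(inv\<^bsub>U\<^esub> v \<otimes>\<^bsub>U\<^esub> act e v, e) \<in> I"
proof -
  have N: "I \<lhd> mult_group" using assms(1) by (simp add: brace_ideal_def)
  have e [simp]: "e \<in> carrier E"
    using subgroup.mem_carrier[OF normal_imp_subgroup[OF N] assms(2)] by simp
  have "(inv\<^bsub>U\<^esub> v, \<one>\<^bsub>E\<^esub>) \<otimes>\<^bsub>mult_group\<^esub> (\<one>\<^bsub>U\<^esub>, e) \<otimes>\<^bsub>mult_group\<^esub>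
      inv\<^bsub>mult_group\<^esub> (inv\<^bsub>U\<^esub> v, \<one>\<^bsub>E\<^esub>) \<in> I"
    using assms(2,3) by (intro normal.inv_op_closed2[OF N]) auto
  then show ?thesis using assms(3) by (simp add: mult_group_inv act_one)
qed

text \<open>Nondegeneracy makes the part \<open>J\<close> of a nonzero ideal inside \<open>E\<close>
  nonzero, and irreducibility then makes it all of \<open>E\<close>. Every \<open>w\<close> in
  \<open>U\<close> is a displacement, so some (w, e) lies in the ideal, and adding elements of
  \<open>E\<close> reaches every (w, f).\<close>

lemma simple_left_brace:
  assumes nontrivial: "carrier E \<noteq> {\<one>\<^bsub>E\<^esub>}"
    and nondegenerate: "\<And>u. \<lbrakk>u \<in> carrier U; u \<noteq> \<one>\<^bsub>U\<^esub>\<rbrakk> \<Longrightarrow> \<exists>v\<in>carrier U. b u v \<noteq> \<one>\<^bsub>E\<^esub>"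
    and displacement: "\<And>w. w \<in> carrier U \<Longrightarrow>
      \<exists>e\<in>carrier E. \<exists>v\<in>carrier U. inv\<^bsub>U\<^esub> v \<otimes>\<^bsub>U\<^esub> act e v = w"
    and irreducible: "\<And>J. \<lbrakk>subgroup J E; J \<noteq> {\<one>\<^bsub>E\<^esub>};
        \<And>e v w. \<lbrakk>e \<in> J; v \<in> carrier U; w \<in> carrier U\<rbrakk> \<Longrightarrow> b (inv\<^bsub>U\<^esub> v \<otimes>\<^bsub>U\<^esub> act e v) w \<in> J\<rbrakk>
      \<Longrightarrow> J = carrier E"
  shows "simple_left_brace add_group mult_group"
  unfolding simple_left_brace_def
proof (intro conjI allI impI left_brace)
  show "carrier add_group \<noteq> {\<one>\<^bsub>add_group\<^esub>}"
    using nontrivial by auto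
next
  fix I assume I: "brace_ideal add_group mult_group I"
  have sub: "subgroup I add_group"
    using I by (auto simp: brace_ideal_def brace_left_ideal_def)
  define J where "J = {e. (\<one>\<^bsub>U\<^esub>, e) \<in> I}"
  have J: "subgroup J E"
  proof (rule E.subgroupI)
    show "J \<subseteq> carrier E" "J \<noteq> {}"
      using subgroup.mem_carrier[OF sub] subgroup.one_closed[OF sub] by (auto simp: J_def)
    then show "inv\<^bsub>E\<^esub> e \<in> J" if "e \<in> J" for e
      using that subgroup.m_inv_closed[OF sub, of "(\<one>\<^bsub>U\<^esub>, e)"] by (auto simp: J_def add_group_inv)
    show "e \<otimes>\<^bsub>E\<^esub> f \<in> J" if "e \<in> J" "f \<in> J" for e f
      using that \<open>J \<subseteq> carrier E\<close> subgroup.m_closed[OF sub, of "(\<one>\<^bsub>U\<^esub>, e)" "(\<one>\<^bsub>U\<^esub>, f)"]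
      by (auto simp: J_def subset_iff)
  qed
  show "I = {\<one>\<^bsub>add_group\<^esub>} \<or> I = carrier add_group"
  proof (cases "I = {\<one>\<^bsub>add_group\<^esub>}")
    case False
    then obtain u e where ue: "(u, e) \<in> I" "(u, e) \<noteq> (\<one>\<^bsub>U\<^esub>, \<one>\<^bsub>E\<^esub>)"
      using subgroup.one_closed[OF sub] by auto
    have JN: "J \<noteq> {\<one>\<^bsub>E\<^esub>}"
    proof (cases "u = \<one>\<^bsub>U\<^esub>")
      case True
      then show ?thesis using ue by (auto simp: J_def)
    next
      case False
      then obtain v where "v \<in> carrier U" "b u v \<noteq> \<one>\<^bsub>E\<^esub>"
        using nondegenerate subgroup.mem_carrier[OF sub ue(1)] by auto
      then show ?thesis using ideal_form_in[OF I ue(1)] by (auto simp: J_def)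
    qed
    have JE: "J = carrier E"
    proof (rule irreducible[OF J JN])
      show "b (inv\<^bsub>U\<^esub> v \<otimes>\<^bsub>U\<^esub> act e v) w \<in> J" if "e \<in> J" "v \<in> carrier U" "w \<in> carrier U" for e v w
        using ideal_form_in[OF I ideal_act_in[OF I]] that by (simp add: J_def)
    qed
    have "(w, f) \<in> I" if "w \<in> carrier U" "f \<in> carrier E" for w f
    proof -
      obtain e v where ev: "e \<in> carrier E" "v \<in> carrier U" "inv\<^bsub>U\<^esub> v \<otimes>\<^bsub>U\<^esub> act e v = w"
        using displacement[OF \<open>w \<in> carrier U\<close>] by blast
      then have "(w, e) \<in> I"
        using ideal_act_in[OF I, of e v] JE by (auto simp: J_def)
      moreover have "(\<one>\<^bsub>U\<^esub>, inv\<^bsub>E\<^esub> e \<otimes>\<^bsub>E\<^esub> f) \<in> I"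
        using that ev JE by (auto simp: J_def)
      ultimately show ?thesis
        using subgroup.m_closed[OF sub, of "(w, e)" "(\<one>\<^bsub>U\<^esub>, inv\<^bsub>E\<^esub> e \<otimes>\<^bsub>E\<^esub> f)"] that ev
        by (simp flip: E.m_assoc)
    qed
    then have "I = carrier add_group"
      using subgroup.subset[OF sub] by auto
    then show ?thesis ..
  qed simp
qed

section \<open>Derived length and Sylow subgroups of the semidirect product\<close>

lemma snd_hom: "snd \<in> hom mult_group E"
  by (auto simp: hom_def)

lemma snd_commutator:
  assumes "x \<in> carrier mult_group" "y \<in> carrier mult_group"
  shows "snd (x \<otimes>\<^bsub>mult_group\<^esub> y \<otimes>\<^bsub>mult_group\<^esub> inv\<^bsub>mult_group\<^esub> x \<otimes>\<^bsub>mult_group\<^esub> inv\<^bsub>mult_group\<^esub> y) = \<one>\<^bsub>E\<^esub>"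
proof -
  interpret h: group_hom mult_group E snd
    using snd_hom by unfold_locales
  have "snd x \<in> carrier E" "snd y \<in> carrier E" using assms by auto
  then have "snd x \<otimes>\<^bsub>E\<^esub> snd y \<otimes>\<^bsub>E\<^esub> inv\<^bsub>E\<^esub> snd x \<otimes>\<^bsub>E\<^esub> inv\<^bsub>E\<^esub> snd y = \<one>\<^bsub>E\<^esub>"
    by (metis E.inv_closed E.inv_solve_right E.l_one E.m_closed E.m_comm E.one_closed)
  then show ?thesis
    using assms by (simp del: mult_group_simps add: h.hom_mult h.hom_inv)
qed

text \<open>The kernel \<open>K\<close> of \<open>snd\<close> contains all commutators because
  \<open>E\<close> is abelian, and \<open>K\<close> is itself abelian because the identity of
  \<open>E\<close> acts trivially on \<open>U\<close>.\<close>

lemma metabelian_mult_group: "metabelian mult_group"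
proof -
  define K where "K = carrier U \<times> {\<one>\<^bsub>E\<^esub>}"
  have "subgroup K mult_group"
    by (rule mul.subgroupI) (auto simp: K_def mult_group_inv act_one)
  moreover have "derived_set mult_group (carrier mult_group) \<subseteq> K"
  proof
    fix z assume "z \<in> derived_set mult_group (carrier mult_group)"
    then obtain x y where xy: "x \<in> carrier mult_group" "y \<in> carrier mult_group"
      and z: "z = x \<otimes>\<^bsub>mult_group\<^esub> y \<otimes>\<^bsub>mult_group\<^esub> inv\<^bsub>mult_group\<^esub> x \<otimes>\<^bsub>mult_group\<^esub> inv\<^bsub>mult_group\<^esub> y"
      by blast
    then have "z \<in> carrier mult_group" by (simp del: mult_group_simps)
    then show "z \<in> K" using snd_commutator[OF xy] z by (auto simp: K_def simp del: mult_group_simps(2))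
  qed
  ultimately have D: "derived mult_group (carrier mult_group) \<subseteq> K"
    unfolding derived_def by (intro mul.generate_subgroup_incl)
  have "x \<otimes>\<^bsub>mult_group\<^esub> y \<otimes>\<^bsub>mult_group\<^esub> inv\<^bsub>mult_group\<^esub> x \<otimes>\<^bsub>mult_group\<^esub> inv\<^bsub>mult_group\<^esub> y = \<one>\<^bsub>mult_group\<^esub>"
    if "x \<in> K" "y \<in> K" for x y
  proof -
    have xy: "x \<in> carrier mult_group" "y \<in> carrier mult_group" using that by (auto simp: K_def)
    have "x \<otimes>\<^bsub>mult_group\<^esub> y = y \<otimes>\<^bsub>mult_group\<^esub> x"
      using that by (auto simp: K_def act_one U.m_comm)
    then show ?thesis using xy
      by (metis mul.inv_closed mul.inv_solve_right mul.l_one mul.m_closed mul.one_closed)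
  qed
  then have "derived_set mult_group (derived mult_group (carrier mult_group)) \<subseteq> {\<one>\<^bsub>mult_group\<^esub>}"
    using D by blast
  then have "derived mult_group (derived mult_group (carrier mult_group)) \<subseteq> {\<one>\<^bsub>mult_group\<^esub>}"
    unfolding derived_def by (intro mul.generate_subgroup_incl mul.triv_subgroup)
  moreover have "\<one>\<^bsub>mult_group\<^esub> \<in> derived mult_group (derived mult_group (carrier mult_group))"
    unfolding derived_def by (rule generate.one)
  ultimately show ?thesis
    unfolding metabelian_def by blast
qed

text \<open>All elements of a Sylow \<open>q\<close>-subgroup, commutators included, are killed by a
  common power of \<open>q\<close>. The hypothesis is what this leaves to check about the action: a
  commutator of such elements that is itself killed must vanish.\<close>

lemma all_sylow_abelian_mult_group:
  assumes prime_part: "\<And>q k e f u v. \<lbrakk>Factorial_Ring.prime q; e \<in> carrier E; f \<in> carrier E;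
      u \<in> carrier U; v \<in> carrier U; e [^]\<^bsub>E\<^esub> (q ^ k :: nat) = \<one>\<^bsub>E\<^esub>; f [^]\<^bsub>E\<^esub> (q ^ k :: nat) = \<one>\<^bsub>E\<^esub>;
      ((u \<otimes>\<^bsub>U\<^esub> act e v) \<otimes>\<^bsub>U\<^esub> inv\<^bsub>U\<^esub> (v \<otimes>\<^bsub>U\<^esub> act f u)) [^]\<^bsub>U\<^esub> (q ^ k :: nat) = \<one>\<^bsub>U\<^esub>\<rbrakk>
    \<Longrightarrow> u \<otimes>\<^bsub>U\<^esub> act e v = v \<otimes>\<^bsub>U\<^esub> act f u"
  shows "all_sylow_abelian mult_group"
  unfolding all_sylow_abelian_def
proof (intro allI impI)
  fix q P assume "sylow_subgroup mult_group q P"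
  then have q: "Factorial_Ring.prime q" and P: "subgroup P mult_group"
    and "\<exists>k. card P = q ^ k" by (auto simp: sylow_subgroup_def)
  then obtain k where k: "card P = q ^ k" by blast
  interpret h: group_hom mult_group E snd
    using snd_hom by unfold_locales
  interpret P: subgroup P mult_group by (rule P)
  have pow: "x [^]\<^bsub>mult_group\<^esub> (q ^ k) = \<one>\<^bsub>mult_group\<^esub>" if "x \<in> P" for x
  proof -
    interpret PG: group "mult_group\<lparr>carrier := P\<rparr>" by (rule mul.subgroup_imp_group[OF P])
    have "x [^]\<^bsub>mult_group\<lparr>carrier := P\<rparr>\<^esub> order (mult_group\<lparr>carrier := P\<rparr>) = \<one>\<^bsub>mult_group\<lparr>carrier := P\<rparr>\<^esub>"
      using PG.pow_order_eq_1[of x] that by simp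
    then show ?thesis by (simp add: order_def k nat_pow_def)
  qed
  have powE: "snd x [^]\<^bsub>E\<^esub> (q ^ k) = \<one>\<^bsub>E\<^esub>" if "x \<in> P" for x
    using pow[OF that] h.hom_nat_pow[of x "q ^ k"] P.mem_carrier[OF that] by simp
  have powU: "(u, \<one>\<^bsub>E\<^esub>) [^]\<^bsub>mult_group\<^esub> (j::nat) = (u [^]\<^bsub>U\<^esub> j, \<one>\<^bsub>E\<^esub>)" if "u \<in> carrier U" for u j
    by (induction j) (use that in \<open>auto simp: act_one\<close>)
  have "x \<otimes>\<^bsub>mult_group\<^esub> y = y \<otimes>\<^bsub>mult_group\<^esub> x" if "x \<in> P" "y \<in> P" for x y
  proof -
    obtain u e v f where xy: "x = (u, e)" "y = (v, f)" by (cases x, cases y)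
    have c [simp]: "u \<in> carrier U" "v \<in> carrier U" "e \<in> carrier E" "f \<in> carrier E"
      using that P.mem_carrier xy by auto
    \<comment> \<open>This is the \<open>U\<close>-component of x y (y x)^(-1); the
      \<open>E\<close>-component of that quotient is trivial, so (w, 0) lies in
      \<open>P\<close>.\<close>
    define w where "w = (u \<otimes>\<^bsub>U\<^esub> act e v) \<otimes>\<^bsub>U\<^esub> inv\<^bsub>U\<^esub> (v \<otimes>\<^bsub>U\<^esub> act f u)"
    have w: "w \<in> carrier U" by (simp add: w_def)
    have "(w, \<one>\<^bsub>E\<^esub>) \<otimes>\<^bsub>mult_group\<^esub> (y \<otimes>\<^bsub>mult_group\<^esub> x) = x \<otimes>\<^bsub>mult_group\<^esub> y"
      by (simp add: xy w_def act_one U.m_assoc E.m_comm)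
    moreover have "(w, \<one>\<^bsub>E\<^esub>) \<in> carrier mult_group" "x \<in> carrier mult_group" "y \<in> carrier mult_group"
      using w by (auto simp: xy)
    ultimately have "(w, \<one>\<^bsub>E\<^esub>) =
        x \<otimes>\<^bsub>mult_group\<^esub> y \<otimes>\<^bsub>mult_group\<^esub> inv\<^bsub>mult_group\<^esub> (y \<otimes>\<^bsub>mult_group\<^esub> x)"
      by (intro mul.inv_solve_right[THEN iffD2] mul.m_closed) auto
    then have "(w, \<one>\<^bsub>E\<^esub>) \<in> P" using that by simp
    then have "w [^]\<^bsub>U\<^esub> (q ^ k) = \<one>\<^bsub>U\<^esub>" using pow powU[OF w] by fastforce
    then have "u \<otimes>\<^bsub>U\<^esub> act e v = v \<otimes>\<^bsub>U\<^esub> act f u"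
      using prime_part[OF q, of e f u v k] powE[OF that(1)] powE[OF that(2)] by (simp add: xy w_def)
    then show ?thesis by (simp add: xy E.m_comm)
  qed
  then show "comm_group (mult_group\<lparr>carrier := P\<rparr>)"
    using mul.subgroup_imp_group[OF P] by (intro group.group_comm_groupI) auto
qed

end

subsection \<open>Periodic functions of sum zero\<close>

lemma mod_sum_mod_cong:
  fixes f g :: "'i \<Rightarrow> int"
  assumes "\<And>x. x \<in> S \<Longrightarrow> f x mod m = g x mod m"
  shows "sum f S mod m = sum g S mod m"
  by (metis (no_types, lifting) assms mod_sum_eq sum.cong)

lemma sum_periodic_shift:
  fixes g :: "int \<Rightarrow> int"
  assumes "q > 0" and per: "\<And>t. g (t mod q) = g t"
  shows "(\<Sum>t = 0..<q. g (t + x)) = (\<Sum>t = 0..<q. g t)"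
  by (rule sum.reindex_bij_witness[of _ "\<lambda>t. (t - x) mod q" "\<lambda>t. (t + x) mod q"])
     (use assms in \<open>auto simp: mod_simps\<close>)

text \<open>Functions on Z/q are encoded as q-periodic functions on the integers, so shifts by
  arbitrary integers make sense; values are canonical residues, so congruence modulo
  \<open>m\<close> is plain equality.\<close>

definition zero_sum :: "int \<Rightarrow> int \<Rightarrow> (int \<Rightarrow> int) set" where
  "zero_sum q m = {w. (\<forall>t. 0 \<le> w t \<and> w t < m \<and> w (t mod q) = w t) \<and> m dvd (\<Sum>t = 0..<q. w t)}"

lemma zero_sum_range:
  assumes "w \<in> zero_sum q m" shows "0 \<le> w t" "w t < m" "w t mod m = w t"
  using assms by (auto simp: zero_sum_def)

lemma zero_sum_mod: "w \<in> zero_sum q m \<Longrightarrow> w (t mod q) = w t"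
  by (auto simp: zero_sum_def)

lemma zero_sum_add_mod: "w \<in> zero_sum q m \<Longrightarrow> w (t + x mod q) = w (t + x)"
  by (metis mod_add_right_eq zero_sum_mod)

lemma zero_sum_zero: "m > 0 \<Longrightarrow> (\<lambda>_. 0) \<in> zero_sum q m"
  by (auto simp: zero_sum_def)

lemma zero_sum_add:
  assumes "m > 0" "u \<in> zero_sum q m" "v \<in> zero_sum q m"
  shows "(\<lambda>t. (u t + v t) mod m) \<in> zero_sum q m"
proof -
  have "(\<Sum>t = 0..<q. (u t + v t) mod m) mod m = (sum u {0..<q} + sum v {0..<q}) mod m"
    by (simp only: mod_sum_eq sum.distrib)
  moreover have "m dvd sum u {0..<q} + sum v {0..<q}" using assms by (auto simp: zero_sum_def)
  ultimately have "m dvd (\<Sum>t = 0..<q. (u t + v t) mod m)" by (simp only: dvd_eq_mod_eq_0)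
  then show ?thesis using assms(1) by (simp add: zero_sum_def zero_sum_mod[OF assms(2)] zero_sum_mod[OF assms(3)])
qed

lemma zero_sum_minus:
  assumes "m > 0" "u \<in> zero_sum q m"
  shows "(\<lambda>t. (- u t) mod m) \<in> zero_sum q m"
proof -
  have "(\<Sum>t = 0..<q. (- u t) mod m) mod m = (- sum u {0..<q}) mod m"
    by (simp add: mod_sum_eq flip: sum_negf)
  moreover have "m dvd - sum u {0..<q}" using assms by (auto simp: zero_sum_def)
  ultimately have "m dvd (\<Sum>t = 0..<q. (- u t) mod m)" by (simp only: dvd_eq_mod_eq_0)
  then show ?thesis using assms(1) by (simp add: zero_sum_def zero_sum_mod[OF assms(2)])
qed

lemma zero_sum_shift:
  assumes "q > 0" "u \<in> zero_sum q m"
  shows "(\<lambda>t. u (t + x)) \<in> zero_sum q m"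
proof -
  have "u (t mod q + x) = u (t + x)" for t
    using zero_sum_mod[OF assms(2)] by (metis mod_add_left_eq)
  moreover have "(\<Sum>t = 0..<q. u (t + x)) = (\<Sum>t = 0..<q. u t)"
    using assms by (intro sum_periodic_shift) (auto simp: zero_sum_mod)
  ultimately show ?thesis using assms by (auto simp: zero_sum_def)
qed

text \<open>A constant function has sum \<open>q * u 0\<close>, and \<open>m\<close> is a prime
  different from \<open>q\<close>, so \<open>m\<close> divides \<open>u 0\<close>. This is where the
  two labels of an arc have to differ.\<close>

lemma zero_sum_const:
  assumes "Factorial_Ring.prime q" "Factorial_Ring.prime m" "q \<noteq> m"
    and "u \<in> zero_sum q m" "\<And>t. t \<in> {0..<q} \<Longrightarrow> u t = u 0"
  shows "u t = 0"
proof -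
  have "m dvd (\<Sum>t = 0..<q. u t)" using assms(4) by (simp add: zero_sum_def)
  also have "(\<Sum>t = 0..<q. u t) = (\<Sum>t = 0..<q. u 0)" by (intro sum.cong refl assms(5))
  also have "\<dots> = q * u 0" using assms(1) by (simp add: prime_ge_0_int)
  finally have "m dvd u 0"
    using assms(1-3) primes_dvd_imp_eq[of m q] by (auto simp: prime_dvd_mult_iff)
  then have "u 0 = 0" using zero_sum_range(3)[OF assms(4), of 0] by simp
  then show ?thesis
    using assms(5)[of "t mod q"] zero_sum_mod[OF assms(4), of t] prime_gt_0_int[OF assms(1)] by simp
qed

text \<open>Since \<open>x\<close> is invertible modulo \<open>q\<close>, its multiples meet every
  residue class, so invariance under \<open>x\<close> forces \<open>u\<close> to be
  constant.\<close>

lemma zero_sum_shift_invariant: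
  assumes "Factorial_Ring.prime q" "Factorial_Ring.prime m" "q \<noteq> m"
    and u: "u \<in> zero_sum q m" and "\<not> q dvd x" and inv: "\<And>t. u (t + x) = u t"
  shows "u t = 0"
proof (rule zero_sum_const[OF assms(1-4)])
  fix s
  have mult: "u (int k * x) = u 0" for k
  proof (induction k)
    case (Suc k)
    then show ?case using inv[of "int k * x"] by (simp add: algebra_simps)
  qed simp
  have "coprime x q" using assms(1,5) by (simp add: prime_imp_coprime coprime_commute)
  then obtain y z where "y * x + z * q = 1"
    using bezout_int[of x q] by (metis coprime_imp_gcd_eq_1)
  then have y: "(x * y) mod q = 1 mod q" by (metis mod_mult_self2 mult.commute)
  define k where "k = nat ((y * s) mod q)"
  have k: "int k = (y * s) mod q" using prime_gt_0_int[OF assms(1)] by (simp add: k_def)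
  have "(int k * x) mod q = ((x * y) mod q * s) mod q"
    unfolding k by (simp add: mod_simps algebra_simps)
  also have "\<dots> = s mod q" by (simp only: y) (simp add: mod_simps)
  finally show "u s = u 0" using mult[of k] zero_sum_mod[OF u] by metis
qed

text \<open>The difference of two point masses, with \<open>m - 1\<close> standing for -1; these are
  the test functions of what follows.\<close>

lemma zero_sum_difference:
  assumes "m > 1" "s \<in> {0..<q}" "t \<in> {0..<q}" "s \<noteq> t"
  shows "(\<lambda>x. if x mod q = s then 1 else if x mod q = t then m - 1 else 0) \<in> zero_sum q m"
proof -
  have "(\<Sum>x = 0..<q. if x mod q = s then 1 else if x mod q = t then m - 1 else 0)
      = (\<Sum>x = 0..<q. (if x = s then 1 else 0) + (if x = t then m - 1 else 0))"
    using assms by (intro sum.cong) auto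
  also have "\<dots> = m" using assms by (simp add: sum.distrib)
  finally show ?thesis using assms by (auto simp: zero_sum_def)
qed

text \<open>A nonzero \<open>u\<close> is not constant, so u(s) differs from u(0) for some
  \<open>s\<close>, and pairing \<open>u\<close> with the difference of point masses at
  \<open>s\<close> and 0 returns u(s) - u(0).\<close>

lemma zero_sum_nondegenerate:
  assumes "Factorial_Ring.prime q" "Factorial_Ring.prime m" "q \<noteq> m"
    and u: "u \<in> zero_sum q m" and "u t \<noteq> 0"
  shows "\<exists>v\<in>zero_sum q m. (\<Sum>x = 0..<q. u x * v x) mod m \<noteq> 0"
proof -
  obtain s where s: "s \<in> {0..<q}" "u s \<noteq> u 0"
    using zero_sum_const[OF assms(1-4)] \<open>u t \<noteq> 0\<close> by blast
  have pos: "q > 0" "m > 1" using assms prime_gt_0_int prime_gt_1_int by auto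
  define v where "v = (\<lambda>x. if x mod q = s then 1 else if x mod q = 0 then m - 1 else 0)"
  have "s \<noteq> 0" using s by auto
  then have "v \<in> zero_sum q m"
    unfolding v_def using s pos by (intro zero_sum_difference) auto
  moreover have "(\<Sum>x = 0..<q. u x * v x)
      = (\<Sum>x = 0..<q. (if x = s then u s else 0) + (if x = 0 then u 0 * (m - 1) else 0))"
    using \<open>s \<noteq> 0\<close> by (intro sum.cong) (auto simp: v_def)
  then have "(\<Sum>x = 0..<q. u x * v x) = (u s - u 0) + m * u 0"
    using s pos by (simp add: sum.distrib algebra_simps)
  then have "(\<Sum>x = 0..<q. u x * v x) mod m = (u s - u 0) mod m" by simp
  then have "(\<Sum>x = 0..<q. u x * v x) mod m \<noteq> 0"
    using s(2) zero_sum_range[OF u] by (metis mod_eq_dvd_iff dvd_eq_mod_eq_0)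
  ultimately show ?thesis by blast
qed

text \<open>The values at 1, ..., q - 1 are free and determine the value at 0 as minus their sum;
  \<open>ext\<close> is this reconstruction.\<close>

lemma card_zero_sum:
  assumes "q > 0" "m > 0"
  shows "finite (zero_sum q m)" "card (zero_sum q m) = nat m ^ (nat q - 1)"
proof -
  define F where "F = {1..<q} \<rightarrow>\<^sub>E {0..<m}"
  define ext where "ext = (\<lambda>g t. if t mod q = 0 then (- (\<Sum>t = 1..<q. g t)) mod m else g (t mod q) :: int)"
  have rem: "t mod q \<in> {1..<q}" if "t mod q \<noteq> 0" for t
    using that pos_mod_bound[OF assms(1), of t] pos_mod_sign[OF assms(1), of t]
    unfolding atLeastLessThan_iff by linarith
  have split0: "{0..<q} = insert 0 {1..<q}" using assms by auto
  have "bij_betw (\<lambda>w. restrict w {1..<q}) (zero_sum q m) F"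
  proof (rule bij_betw_byWitness[where f' = ext])
    show "\<forall>w\<in>zero_sum q m. ext (restrict w {1..<q}) = w"
    proof (intro ballI ext)
      fix w t assume w: "w \<in> zero_sum q m"
      have "m dvd w 0 + sum w {1..<q}" using w by (simp add: zero_sum_def split0)
      then have "w 0 mod m = (- sum w {1..<q}) mod m"
        by (simp add: mod_eq_dvd_iff)
      then have w0: "(- sum w {1..<q}) mod m = w 0" using zero_sum_range(3)[OF w] by simp
      show "ext (restrict w {1..<q}) t = w t"
      proof (cases "t mod q = 0")
        case True
        then show ?thesis using w0 zero_sum_mod[OF w, of t] by (simp add: ext_def)
      next
        case False
        then have "t mod q \<in> {1..<q}" by (rule rem)
        then show ?thesis using False zero_sum_mod[OF w, of t] by (simp add: ext_def)
      qed
    qed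
    show "\<forall>g\<in>F. restrict (ext g) {1..<q} = g"
    proof (intro ballI HOL.ext)
      fix g t assume "g \<in> F"
      then show "restrict (ext g) {1..<q} t = g t"
        by (cases "t \<in> {1..<q}") (auto simp: F_def ext_def)
    qed
    show "(\<lambda>w. restrict w {1..<q}) ` zero_sum q m \<subseteq> F"
      by (auto simp: F_def zero_sum_def)
    show "ext ` F \<subseteq> zero_sum q m"
    proof clarify
      fix g assume g: "g \<in> F"
      have range: "0 \<le> ext g t \<and> ext g t < m" for t
      proof (cases "t mod q = 0")
        case False
        then have "t mod q \<in> {1..<q}" by (rule rem)
        then have "g (t mod q) \<in> {0..<m}" using g by (auto simp: F_def)
        then show ?thesis using False by (simp add: ext_def)
      qed (use assms in \<open>simp add: ext_def\<close>)
      have "(\<Sum>t = 1..<q. ext g t) = (\<Sum>t = 1..<q. g t)"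
        by (rule sum.cong) (auto simp: ext_def)
      then have "(\<Sum>t = 0..<q. ext g t) = (- (\<Sum>t = 1..<q. g t)) mod m + (\<Sum>t = 1..<q. g t)"
        by (simp add: split0) (simp add: ext_def)
      moreover have "m dvd \<dots>" by (simp add: dvd_eq_mod_eq_0 mod_simps)
      ultimately show "ext g \<in> zero_sum q m"
        using range by (auto simp: zero_sum_def) (auto simp: ext_def)
    qed
  qed
  moreover have "finite F" "card F = nat m ^ (nat q - 1)"
    using assms by (auto simp: F_def card_PiE finite_PiE nat_diff_distrib)
  ultimately show "finite (zero_sum q m)" "card (zero_sum q m) = nat m ^ (nat q - 1)"
    by (auto simp: bij_betw_same_card dest: bij_betw_finite)
qed

subsection \<open>Braces from digraphs labelled by primes\<close>

locale prime_digraph =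
  fixes A :: "'a set" and C :: "'c set" and src tgt :: "'c \<Rightarrow> 'a" and \<pi> :: "'a \<Rightarrow> int"
  assumes finite_vertices: "finite A" and finite_arcs: "finite C"
    and nonempty: "A \<noteq> {}"
    and prime_label: "a \<in> A \<Longrightarrow> Factorial_Ring.prime (\<pi> a)"
    and label_outside: "a \<notin> A \<Longrightarrow> \<pi> a = 1"
    and src_in: "c \<in> C \<Longrightarrow> src c \<in> A"
    and tgt_in: "c \<in> C \<Longrightarrow> tgt c \<in> A"
    and labels_distinct: "c \<in> C \<Longrightarrow> \<pi> (src c) \<noteq> \<pi> (tgt c)"
    and strongly_connected: "\<lbrakk>a \<in> A; a' \<in> A\<rbrakk> \<Longrightarrow> (a, a') \<in> {(src c, tgt c) |c. c \<in> C}\<^sup>+"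
begin

text \<open>Modulus 1 forces everything indexed outside the digraph to vanish, as does
$\pi$ outside the vertex set; this makes the group laws uniform in the index.\<close>

definition modulus :: "'c \<Rightarrow> int" where
  "modulus c = (if c \<in> C then \<pi> (tgt c) else 1)"

lemma label_pos [simp]: "\<pi> a > 0"
  by (cases "a \<in> A") (auto simp: prime_gt_0_int prime_label label_outside)

lemma modulus_pos [simp]: "modulus c > 0"
  by (simp add: modulus_def)

definition E :: "('a \<Rightarrow> int) monoid" where
  "E = \<lparr>carrier = {e. \<forall>a. e a \<in> {0..<\<pi> a}}, monoid.mult = (\<lambda>e f a. (e a + f a) mod \<pi> a), one = (\<lambda>_. 0)\<rparr>"

definition U :: "('c \<Rightarrow> int \<Rightarrow> int) monoid" where
  "U = \<lparr>carrier = {u. \<forall>c. u c \<in> zero_sum (\<pi> (src c)) (modulus c)},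
     monoid.mult = (\<lambda>u v c t. (u c t + v c t) mod modulus c), one = (\<lambda>_ _. 0)\<rparr>"

definition shift :: "('a \<Rightarrow> int) \<Rightarrow> ('c \<Rightarrow> int \<Rightarrow> int) \<Rightarrow> 'c \<Rightarrow> int \<Rightarrow> int" where
  "shift e u c t = u c (t + e (src c))"

definition form :: "('c \<Rightarrow> int \<Rightarrow> int) \<Rightarrow> ('c \<Rightarrow> int \<Rightarrow> int) \<Rightarrow> 'a \<Rightarrow> int" where
  "form u v a = (\<Sum>c\<in>{c \<in> C. tgt c = a}. \<Sum>t = 0..<\<pi> (src c). u c t * v c t) mod \<pi> a"

lemma E_simps [simp]:
  "carrier E = {e. \<forall>a. e a \<in> {0..<\<pi> a}}"
  "e \<otimes>\<^bsub>E\<^esub> f = (\<lambda>a. (e a + f a) mod \<pi> a)"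
  "\<one>\<^bsub>E\<^esub> = (\<lambda>_. 0)"
  by (auto simp: E_def)

lemma U_simps [simp]:
  "carrier U = {u. \<forall>c. u c \<in> zero_sum (\<pi> (src c)) (modulus c)}"
  "u \<otimes>\<^bsub>U\<^esub> v = (\<lambda>c t. (u c t + v c t) mod modulus c)"
  "\<one>\<^bsub>U\<^esub> = (\<lambda>_ _. 0)"
  by (auto simp: U_def)

lemma comm_group_E: "comm_group E"
proof (rule comm_groupI)
  fix e assume "e \<in> carrier E"
  then show "\<exists>f\<in>carrier E. f \<otimes>\<^bsub>E\<^esub> e = \<one>\<^bsub>E\<^esub>"
    by (intro bexI[of _ "\<lambda>a. (- e a) mod \<pi> a"]) (auto simp: mod_simps)
qed (auto simp: mod_simps algebra_simps)

lemma comm_group_U: "comm_group U"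
proof (rule comm_groupI)
  fix e assume "e \<in> carrier U"
  then show "\<exists>f\<in>carrier U. f \<otimes>\<^bsub>U\<^esub> e = \<one>\<^bsub>U\<^esub>"
    by (intro bexI[of _ "\<lambda>c t. (- e c t) mod modulus c"]) (auto simp: mod_simps zero_sum_minus)
next
  fix u assume u: "u \<in> carrier U"
  have "(u c t) mod modulus c = u c t" for c t
    using u zero_sum_range(3) by fastforce
  then show "\<one>\<^bsub>U\<^esub> \<otimes>\<^bsub>U\<^esub> u = u" by simp
qed (auto simp: mod_simps algebra_simps zero_sum_add zero_sum_zero)

lemma U_mod: "u \<in> carrier U \<Longrightarrow> u c t mod modulus c = u c t"
  using zero_sum_range(3)[of "u c" "\<pi> (src c)"] by simp

text \<open>For an arc ending in \<open>a\<close> the inner modulus is \<open>\<pi> a\<close>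
  itself, so the inner reduction disappears under the outer one.\<close>

lemma form_add_left: "form (\<lambda>c t. (u c t + v c t) mod modulus c) w a = (form u w a + form v w a) mod \<pi> a"
proof -
  have "form (\<lambda>c t. (u c t + v c t) mod modulus c) w a
      = (\<Sum>c\<in>{c \<in> C. tgt c = a}. \<Sum>t = 0..<\<pi> (src c). (u c t + v c t) * w c t) mod \<pi> a"
    unfolding form_def
    by (intro mod_sum_mod_cong) (auto simp: modulus_def mod_simps)
  then show ?thesis
    by (simp add: form_def mod_simps distrib_right sum.distrib)
qed

sublocale invariant_form U E shift form
proof (intro invariant_form.intro invariant_form_axioms.intro comm_group_E comm_group_U)
  fix e u assume eu: "e \<in> carrier E" "u \<in> carrier U"
  then show "shift e u \<in> carrier U"
    unfolding shift_def by (auto intro: zero_sum_shift)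
next
  fix e f u assume "e \<in> carrier E" "f \<in> carrier E" and u: "u \<in> carrier U"
  \<comment> \<open>Reducing the shift modulo the period is invisible to a periodic function; this
    makes \<open>shift\<close> an action.\<close>
  have "u c (t + (e (src c) + f (src c)) mod \<pi> (src c)) = u c (t + (e (src c) + f (src c)))" for c t
    using u by (intro zero_sum_add_mod) auto
  then show "shift (e \<otimes>\<^bsub>E\<^esub> f) u = shift e (shift f u)"
    by (intro ext) (simp add: shift_def add.assoc)
next
  fix e u v assume uv: "u \<in> carrier U" "v \<in> carrier U"
  \<comment> \<open>Invariance of the form: both factors move by the same amount, and the sum of a
    periodic function over one period ignores shifts.\<close>
  have "(\<Sum>t = 0..<\<pi> (src c). u c (t + e (src c)) * v c (t + e (src c))) = (\<Sum>t = 0..<\<pi> (src c). u c t * v c t)" for c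
  proof (rule sum_periodic_shift[where g = "\<lambda>t. u c t * v c t"])
    have "u c \<in> zero_sum (\<pi> (src c)) (modulus c)" "v c \<in> zero_sum (\<pi> (src c)) (modulus c)"
      using uv by auto
    then show "u c (t mod \<pi> (src c)) * v c (t mod \<pi> (src c)) = u c t * v c t" for t
      by (simp only: zero_sum_mod)
  qed simp
  then show "form (shift e u) (shift e v) = form u v"
    by (simp add: shift_def form_def fun_eq_iff)
qed (auto simp: shift_def form_add_left form_def mult.commute fun_eq_iff)

section \<open>Inverses, powers and cardinalities of \<open>U\<close> and \<open>E\<close>\<close>

lemma inv_U: "u \<in> carrier U \<Longrightarrow> inv\<^bsub>U\<^esub> u = (\<lambda>c t. (- u c t) mod modulus c)"
  by (rule U.inv_equality) (auto simp: mod_simps zero_sum_minus)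

lemma pow_E: "e [^]\<^bsub>E\<^esub> (k::nat) = (\<lambda>a. (int k * e a) mod \<pi> a)"
  by (induction k) (auto simp: mod_simps algebra_simps)

lemma pow_U: "u [^]\<^bsub>U\<^esub> (k::nat) = (\<lambda>c t. (int k * u c t) mod modulus c)"
  by (induction k) (auto simp: mod_simps algebra_simps)

lemma vanish_E: "\<lbrakk>e \<in> carrier E; a \<notin> A\<rbrakk> \<Longrightarrow> e a = 0"
  using label_outside[of a] by (auto dest: spec[of _ a])

lemma vanish_U: "\<lbrakk>u \<in> carrier U; c \<notin> C\<rbrakk> \<Longrightarrow> u c t = 0"
  using zero_sum_range[of "u c" "\<pi> (src c)" 1 t] by (auto simp: modulus_def dest: spec[of _ c])

lemma card_E: "card (carrier E) = (\<Prod>a\<in>A. nat (\<pi> a))"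
proof -
  have "bij_betw (\<lambda>e. restrict e A) (carrier E) (\<Pi>\<^sub>E a\<in>A. {0..<\<pi> a})"
  proof (rule bij_betw_byWitness[where f' = "\<lambda>e a. if a \<in> A then e a else 0"])
    show "\<forall>e\<in>carrier E. (\<lambda>a. if a \<in> A then restrict e A a else 0) = e"
      using vanish_E by fastforce
    show "\<forall>e\<in>\<Pi>\<^sub>E a\<in>A. {0..<\<pi> a}. restrict (\<lambda>a. if a \<in> A then e a else 0) A = e"
      by (auto simp: PiE_def extensional_def restrict_def)
    show "(\<lambda>e a. if a \<in> A then e a else 0) ` (\<Pi>\<^sub>E a\<in>A. {0..<\<pi> a}) \<subseteq> carrier E"
      by (auto simp: PiE_iff)
  qed auto
  then have "card (carrier E) = card (\<Pi>\<^sub>E a\<in>A. {0..<\<pi> a})" by (rule bij_betw_same_card)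
  then show ?thesis by (simp add: card_PiE finite_vertices)
qed

lemma card_U: "card (carrier U) = (\<Prod>c\<in>C. nat (\<pi> (tgt c)) ^ (nat (\<pi> (src c)) - 1))"
proof -
  let ?W = "\<lambda>c. zero_sum (\<pi> (src c)) (modulus c)"
  have "bij_betw (\<lambda>u. restrict u C) (carrier U) (\<Pi>\<^sub>E c\<in>C. ?W c)"
  proof (rule bij_betw_byWitness[where f' = "\<lambda>u c. if c \<in> C then u c else (\<lambda>_. 0)"])
    show "\<forall>u\<in>carrier U. (\<lambda>c. if c \<in> C then restrict u C c else (\<lambda>_. 0)) = u"
      using vanish_U by (intro ballI ext) auto
    show "\<forall>u\<in>\<Pi>\<^sub>E c\<in>C. ?W c. restrict (\<lambda>c. if c \<in> C then u c else (\<lambda>_. 0)) C = u"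
      by (auto simp: PiE_def extensional_def restrict_def)
    show "(\<lambda>u c. if c \<in> C then u c else (\<lambda>_. 0)) ` (\<Pi>\<^sub>E c\<in>C. ?W c) \<subseteq> carrier U"
      by (auto simp: PiE_iff zero_sum_zero)
  qed auto
  then have "card (carrier U) = card (\<Pi>\<^sub>E c\<in>C. ?W c)" by (rule bij_betw_same_card)
  also have "\<dots> = (\<Prod>c\<in>C. card (?W c))" by (simp add: card_PiE finite_arcs)
  also have "\<dots> = (\<Prod>c\<in>C. nat (\<pi> (tgt c)) ^ (nat (\<pi> (src c)) - 1))"
    by (intro prod.cong) (auto simp: card_zero_sum modulus_def)
  finally show ?thesis .
qed

text \<open>An infinite set has cardinality 0 by convention, so a nonzero product certifies
  finiteness.\<close>

lemma finite_U: "finite (carrier U)"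
proof -
  have "card (carrier U) \<noteq> 0" unfolding card_U by (auto simp: finite_arcs dest: leD)
  then show ?thesis by (meson card.infinite)
qed

lemma card_mult_group: "card (carrier mult_group) =
    (\<Prod>a\<in>A. nat (\<pi> a)) * (\<Prod>c\<in>C. nat (\<pi> (tgt c)) ^ (nat (\<pi> (src c)) - 1))"
  unfolding mult_group_simps(1) card_cartesian_product card_E card_U by simp

section \<open>Test vectors, displacements and irreducibility of \<open>E\<close>\<close>

definition single :: "'c \<Rightarrow> (int \<Rightarrow> int) \<Rightarrow> 'c \<Rightarrow> int \<Rightarrow> int" where
  "single c w c' = (if c' = c then w else (\<lambda>_. 0))"

definition delta :: "'a \<Rightarrow> int \<Rightarrow> 'a \<Rightarrow> int" where
  "delta a x a' = (if a' = a then x else 0)"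

lemma single_in: "w \<in> zero_sum (\<pi> (src c)) (modulus c) \<Longrightarrow> single c w \<in> carrier U"
  by (auto simp: single_def zero_sum_zero)

lemma form_single:
  assumes "c \<in> C"
  shows "form u (single c w) = delta (tgt c) ((\<Sum>t = 0..<\<pi> (src c). u c t * w t) mod \<pi> (tgt c))"
proof
  fix a
  have "(\<Sum>c'\<in>{c \<in> C. tgt c = a}. \<Sum>t = 0..<\<pi> (src c'). u c' t * single c w c' t)
      = (\<Sum>c'\<in>{c \<in> C. tgt c = a}. if c' = c then (\<Sum>t = 0..<\<pi> (src c). u c t * w t) else 0)"
    by (intro sum.cong) (auto simp: single_def)
  then show "form u (single c w) a = delta (tgt c) ((\<Sum>t = 0..<\<pi> (src c). u c t * w t) mod \<pi> (tgt c)) a"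
    using assms finite_arcs by (auto simp: form_def delta_def)
qed

text \<open>Pairing with a vector supported on the one arc \<open>c\<close> silences all other arcs.
  That the value is concentrated at \<open>tgt c\<close> is more than nondegeneracy demands; it
  drives the propagation in \<open>E_irreducible\<close>.\<close>

lemma form_nondegenerate:
  assumes "u \<in> carrier U" "u c t \<noteq> 0"
  shows "\<exists>v\<in>carrier U. \<exists>g. 0 < g \<and> g < \<pi> (tgt c) \<and> form u v = delta (tgt c) g"
proof -
  have c: "c \<in> C" using assms vanish_U by blast
  then have m: "modulus c = \<pi> (tgt c)" by (simp add: modulus_def)
  have uc: "u c \<in> zero_sum (\<pi> (src c)) (\<pi> (tgt c))" using assms(1) unfolding m[symmetric] by simp
  obtain w where w: "w \<in> zero_sum (\<pi> (src c)) (\<pi> (tgt c))"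
      "(\<Sum>t = 0..<\<pi> (src c). u c t * w t) mod \<pi> (tgt c) \<noteq> 0"
    using zero_sum_nondegenerate[OF prime_label[OF src_in] prime_label[OF tgt_in] labels_distinct uc] assms(2) c
    by blast
  let ?g = "(\<Sum>t = 0..<\<pi> (src c). u c t * w t) mod \<pi> (tgt c)"
  have "0 \<le> ?g" "?g < \<pi> (tgt c)" by simp_all
  moreover have "single c w \<in> carrier U" using w m by (intro single_in) simp
  ultimately show ?thesis using form_single[OF c] w(2) by (metis order_le_less)
qed

lemma shift_fixed:
  assumes "u \<in> carrier U" "c \<in> C" "\<not> \<pi> (src c) dvd x" "\<And>t. u c (t + x) = u c t"
  shows "u c t = 0"
proof -
  have m: "modulus c = \<pi> (tgt c)" using assms by (simp add: modulus_def)
  have "u c \<in> zero_sum (\<pi> (src c)) (\<pi> (tgt c))" using assms(1) unfolding m[symmetric] by simp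
  from zero_sum_shift_invariant[OF prime_label[OF src_in] prime_label[OF tgt_in] labels_distinct this assms(3,4)]
  show ?thesis using assms(2) by blast
qed

lemma displacement_in:
  assumes "e \<in> carrier E" "v \<in> carrier U"
  shows "(inv\<^bsub>U\<^esub> v \<otimes>\<^bsub>U\<^esub> shift e v) c t = (v c (t + e (src c)) - v c t) mod modulus c"
  using assms(2) by (simp only: inv_U) (simp add: shift_def mod_simps)

text \<open>On arc \<open>c\<close> the difference of point masses at 0 and 1 is nonzero, so by
  \<open>shift_fixed\<close> it is not invariant under the nontrivial shift
  \<open>e (src c)\<close>.\<close>

lemma displacement_nonzero:
  assumes e: "e \<in> carrier E" "e (src c) \<noteq> 0" and c: "c \<in> C"
  shows "\<exists>v\<in>carrier U. \<exists>t. (inv\<^bsub>U\<^esub> v \<otimes>\<^bsub>U\<^esub> shift e v) c t \<noteq> 0"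
proof -
  define w where "w = (\<lambda>x. if x mod \<pi> (src c) = 0 then 1 else if x mod \<pi> (src c) = 1 then \<pi> (tgt c) - 1 else 0)"
  have gt1: "\<pi> (src c) > 1" "\<pi> (tgt c) > 1" using c prime_label src_in tgt_in prime_gt_1_int by auto
  have "w \<in> zero_sum (\<pi> (src c)) (modulus c)"
    using c gt1 unfolding w_def modulus_def by (auto intro!: zero_sum_difference)
  then have v: "single c w \<in> carrier U" by (rule single_in)
  have "single c w c 0 \<noteq> 0" by (simp add: single_def w_def)
  moreover have "0 \<le> e (src c)" "e (src c) < \<pi> (src c)" using e(1) by auto
  then have "\<not> \<pi> (src c) dvd e (src c)" using e(2) zdvd_not_zless[of "e (src c)" "\<pi> (src c)"] by simp
  ultimately obtain t where t: "single c w c (t + e (src c)) \<noteq> single c w c t"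
    using shift_fixed[OF v c] by blast
  have range: "single c w c t mod modulus c = single c w c t" for t
    using v by (rule U_mod)
  have "(single c w c (t + e (src c)) - single c w c t) mod modulus c \<noteq> 0"
    using t range by (metis mod_eq_dvd_iff dvd_eq_mod_eq_0)
  then show ?thesis using v displacement_in[OF e(1) v] by metis
qed

text \<open>For a suitable \<open>e\<close> the map from \<open>v\<close> to e v - v is injective on
  the finite set \<open>U\<close>, hence surjective.\<close>

lemma displacement_surj:
  assumes "w \<in> carrier U"
  shows "\<exists>e\<in>carrier E. \<exists>v\<in>carrier U. inv\<^bsub>U\<^esub> v \<otimes>\<^bsub>U\<^esub> shift e v = w"
proof -
  \<comment> \<open>Every vertex gets 1, so every arc is shifted by one step; outside the vertex set
    the modulus 1 turns this into 0.\<close>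
  define e where "e = (\<lambda>a. 1 mod \<pi> a)"
  have e: "e \<in> carrier E" by (simp add: e_def)
  let ?d = "\<lambda>v. inv\<^bsub>U\<^esub> v \<otimes>\<^bsub>U\<^esub> shift e v"
  have d: "?d v c t = (v c (t + 1) - v c t) mod modulus c" if v: "v \<in> carrier U" for v c t
    using displacement_in[OF e v] v zero_sum_add_mod[of "v c" "\<pi> (src c)" "modulus c" t 1]
    by (simp add: e_def)
  have "?d ` carrier U \<subseteq> carrier U"
    using e by (auto simp del: U_simps E_simps)
  moreover have "inj_on ?d (carrier U)"
  proof (rule inj_onI)
    fix v v' assume v: "v \<in> carrier U" "v' \<in> carrier U" and eq: "?d v = ?d v'"
    \<comment> \<open>Equal displacements make the difference \<open>z\<close> invariant under the
      unit shift, and a prime does not divide 1, so \<open>z\<close> vanishes by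
      \<open>shift_fixed\<close>.\<close>
    define z where "z = (\<lambda>c t. (v c t - v' c t) mod modulus c)"
    have "z = v \<otimes>\<^bsub>U\<^esub> inv\<^bsub>U\<^esub> v'" using v by (simp only: inv_U) (simp add: z_def mod_simps)
    then have z: "z \<in> carrier U" using v by (simp del: U_simps)
    have "z c (t + 1) = z c t" for c t
    proof -
      have "(v c (t + 1) - v c t) mod modulus c = (v' c (t + 1) - v' c t) mod modulus c"
        using d[OF v(1), of c t] d[OF v(2), of c t] eq by metis
      then show ?thesis by (simp add: z_def mod_eq_dvd_iff algebra_simps)
    qed
    then have "z c t = 0" for c t
      using shift_fixed[OF z, of c 1 t] vanish_U[OF z, of c t] prime_label[OF src_in, of c]
      by (metis not_prime_unit)
    then have "v c t mod modulus c = v' c t mod modulus c" for c t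
      by (simp add: z_def mod_eq_dvd_iff dvd_eq_mod_eq_0)
    moreover have "v c t mod modulus c = v c t" "v' c t mod modulus c = v' c t" for c t
      using v by (simp_all only: U_mod)
    ultimately show "v = v'" by (intro ext) metis
  qed
  ultimately have "?d ` carrier U = carrier U" by (intro endo_inj_surj finite_U)
  then show ?thesis using assms e by (metis (no_types, lifting) imageE)
qed

text \<open>A \<open>g\<close> strictly between 0 and \<open>\<pi> a\<close> exists only at a
  vertex, where the modulus is prime; so \<open>g\<close> is a unit and its multiples fill the
  cyclic factor at \<open>a\<close>.\<close>

lemma delta_generates:
  assumes J: "subgroup J E" and g: "delta a g \<in> J" "0 < g" "g < \<pi> a" and x: "x \<in> {0..<\<pi> a}"
  shows "delta a x \<in> J"
proof -
  have mult: "delta a ((int k * g) mod \<pi> a) \<in> J" for k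
  proof (induction k)
    case 0
    then show ?case using subgroup.one_closed[OF J] by (simp add: delta_def[abs_def])
  next
    case (Suc k)
    have "delta a ((int (Suc k) * g) mod \<pi> a) = delta a ((int k * g) mod \<pi> a) \<otimes>\<^bsub>E\<^esub> delta a g"
      by (auto simp: delta_def mod_simps algebra_simps)
    then show ?case using subgroup.m_closed[OF J Suc g(1)] by simp
  qed
  have "a \<in> A" using g label_outside[of a] by force
  then have "coprime g (\<pi> a)"
    using g prime_label zdvd_not_zless by (metis coprime_commute prime_imp_coprime)
  then obtain y z where "y * g + z * \<pi> a = 1"
    using bezout_int[of g "\<pi> a"] by (metis coprime_imp_gcd_eq_1)
  then have y: "(g * y) mod \<pi> a = 1 mod \<pi> a" by (metis mod_mult_self2 mult.commute)
  define k where "k = nat ((y * x) mod \<pi> a)"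
  have k: "int k = (y * x) mod \<pi> a" by (simp add: k_def)
  have "(int k * g) mod \<pi> a = ((g * y) mod \<pi> a * x) mod \<pi> a"
    unfolding k by (simp add: mod_simps algebra_simps)
  also have "\<dots> = x" by (simp only: y) (use x in \<open>simp add: mod_simps\<close>)
  finally show ?thesis using mult[of k] by simp
qed

text \<open>\<open>S\<close> collects the vertices whose whole cyclic factor lies in
  \<open>J\<close>. One nonzero component at the source of an arc puts the target into
  \<open>S\<close>, so strong connectivity spreads \<open>S\<close> over all vertices.\<close>

lemma E_irreducible:
  assumes J: "subgroup J E" "J \<noteq> {\<one>\<^bsub>E\<^esub>}"
    and closed: "\<And>e v w. \<lbrakk>e \<in> J; v \<in> carrier U; w \<in> carrier U\<rbrakk> \<Longrightarrow> form (inv\<^bsub>U\<^esub> v \<otimes>\<^bsub>U\<^esub> shift e v) w \<in> J"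
  shows "J = carrier E"
proof -
  define S where "S = {a \<in> A. \<forall>x\<in>{0..<\<pi> a}. delta a x \<in> J}"
  have sub: "J \<subseteq> carrier E" using subgroup.subset[OF J(1)] .
  \<comment> \<open>The element \<open>e\<close> may have further nonzero components; pairing its
    displacement on the single arc \<open>c\<close> isolates the target of \<open>c\<close>.\<close>
  have step: "tgt c \<in> S" if e: "e \<in> J" "e (src c) \<noteq> 0" and c: "c \<in> C" for e c
  proof -
    have eE: "e \<in> carrier E" using e sub by blast
    obtain v t where v: "v \<in> carrier U" "(inv\<^bsub>U\<^esub> v \<otimes>\<^bsub>U\<^esub> shift e v) c t \<noteq> 0"
      using displacement_nonzero[OF eE e(2) c] by blast
    moreover have "inv\<^bsub>U\<^esub> v \<otimes>\<^bsub>U\<^esub> shift e v \<in> carrier U"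
      using v eE by (simp del: U_simps E_simps)
    ultimately obtain w g where "w \<in> carrier U" "0 < g" "g < \<pi> (tgt c)"
        "form (inv\<^bsub>U\<^esub> v \<otimes>\<^bsub>U\<^esub> shift e v) w = delta (tgt c) g"
      using form_nondegenerate by blast
    then show ?thesis
      using closed[OF e(1) v(1)] delta_generates[OF J(1)] tgt_in[OF c] by (force simp: S_def simp del: U_simps)
  qed
  obtain e a where e: "e \<in> J" "e a \<noteq> 0"
    using J(2) subgroup.one_closed[OF J(1)] by fastforce
  then have a: "a \<in> A" using vanish_E sub by blast
  \<comment> \<open>The transitive closure contains (a, a), so at least one arc leaves
    \<open>a\<close>.\<close>
  obtain c where "c \<in> C" "src c = a" using tranclD[OF strongly_connected[OF a a]] by auto
  then obtain a0 where a0: "a0 \<in> S" using step e by blast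
  have "a' \<in> S" if "(a0, a') \<in> {(src c, tgt c) |c. c \<in> C}\<^sup>*" for a'
    using that
  proof (induction rule: rtrancl_induct)
    case (step y z)
    then obtain c where c: "c \<in> C" "src c = y" "tgt c = z" by auto
    have "\<pi> y > 1" using c prime_label src_in prime_gt_1_int by blast
    then have "delta y 1 \<in> J" using step by (auto simp: S_def)
    then show ?case using \<open>\<And>e c. \<lbrakk>e \<in> J; e (src c) \<noteq> 0; c \<in> C\<rbrakk> \<Longrightarrow> tgt c \<in> S\<close>[of "delta y 1" c] c
      by (simp add: delta_def)
  qed (rule a0)
  then have S: "S = A" using strongly_connected a0 by (auto simp: S_def dest: trancl_into_rtrancl)
  \<comment> \<open>Any element of \<open>E\<close> is assembled from its components one vertex at a
    time, by induction on a finite set containing its support.\<close>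
  have "e \<in> J" if "finite B" "B \<subseteq> A" "e \<in> carrier E" "\<And>a. a \<notin> B \<Longrightarrow> e a = 0" for B e
    using that
  proof (induction B arbitrary: e rule: finite_induct)
    case empty
    then have "e = \<one>\<^bsub>E\<^esub>" by auto
    then show ?case using subgroup.one_closed[OF J(1)] by simp
  next
    case (insert a B)
    have "e(a := 0) \<in> J"
      using insert.prems insert.hyps by (intro insert.IH) auto
    moreover have "a \<in> S" "e a \<in> {0..<\<pi> a}" using insert.prems S by auto
    then have "delta a (e a) \<in> J" by (simp add: S_def)
    moreover have "e = e(a := 0) \<otimes>\<^bsub>E\<^esub> delta a (e a)"
      using insert.prems(2) by (auto simp: delta_def)
    ultimately show ?case using subgroup.m_closed[OF J(1)] by metis
  qed
  then show ?thesis using sub finite_vertices vanish_E by blast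
qed

section \<open>Simplicity and Sylow subgroups of the digraph brace\<close>

theorem digraph_brace_simple: "simple_left_brace add_group mult_group"
proof (rule simple_left_brace)
  obtain a where a: "a \<in> A" using nonempty by blast
  then have "\<pi> a > 1" using prime_label prime_gt_1_int by blast
  then have "delta a 1 \<in> carrier E" "delta a 1 a \<noteq> 0" by (auto simp: delta_def)
  then show "carrier E \<noteq> {\<one>\<^bsub>E\<^esub>}" by (metis E_simps(3) singletonD)
next
  fix u assume u: "u \<in> carrier U" "u \<noteq> \<one>\<^bsub>U\<^esub>"
  then obtain c t where "u c t \<noteq> 0" by fastforce
  then show "\<exists>v\<in>carrier U. form u v \<noteq> \<one>\<^bsub>E\<^esub>"
    using form_nondegenerate[OF u(1)] by (metis E_simps(3) delta_def less_irrefl)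
next
  show "\<exists>e\<in>carrier E. \<exists>v\<in>carrier U. inv\<^bsub>U\<^esub> v \<otimes>\<^bsub>U\<^esub> shift e v = w" if "w \<in> carrier U" for w
    using that by (rule displacement_surj)
next
  fix J assume "subgroup J E" "J \<noteq> {\<one>\<^bsub>E\<^esub>}"
    "\<And>e v w. \<lbrakk>e \<in> J; v \<in> carrier U; w \<in> carrier U\<rbrakk> \<Longrightarrow> form (inv\<^bsub>U\<^esub> v \<otimes>\<^bsub>U\<^esub> shift e v) w \<in> J"
  then show "J = carrier E" by (rule E_irreducible)
qed

text \<open>Compare coordinates at an arc \<open>c\<close>. If its target is labelled
  \<open>q\<close>, its source is not, so the \<open>q\<close>-power torsion elements
  \<open>e\<close> and \<open>f\<close> vanish there and no shift takes place. If its target has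
  another label, a power of \<open>q\<close> is invertible modulo that label and the torsion
  commutator vanishes. Off the digraph the modulus is 1.\<close>

theorem digraph_brace_sylow: "all_sylow_abelian mult_group"
proof (rule all_sylow_abelian_mult_group)
  fix q k :: nat and e f u v
  assume q: "Factorial_Ring.prime q" and ef: "e \<in> carrier E" "f \<in> carrier E"
    and uv: "u \<in> carrier U" "v \<in> carrier U"
    and e0: "e [^]\<^bsub>E\<^esub> (q ^ k) = \<one>\<^bsub>E\<^esub>" and f0: "f [^]\<^bsub>E\<^esub> (q ^ k) = \<one>\<^bsub>E\<^esub>"
    and w0: "((u \<otimes>\<^bsub>U\<^esub> shift e v) \<otimes>\<^bsub>U\<^esub> inv\<^bsub>U\<^esub> (v \<otimes>\<^bsub>U\<^esub> shift f u)) [^]\<^bsub>U\<^esub> (q ^ k) = \<one>\<^bsub>U\<^esub>"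
  have cop: "m dvd x" if "Factorial_Ring.prime m" "m \<noteq> int q" "m dvd int (q ^ k) * x" for m x :: int
    using that q by (metis of_nat_power prime_dvd_mult_iff prime_dvd_power primes_dvd_imp_eq prime_nat_int_transfer)
  have vanish: "g a = 0" if "g \<in> carrier E" "g [^]\<^bsub>E\<^esub> (q ^ k) = \<one>\<^bsub>E\<^esub>" "a \<in> A" "\<pi> a \<noteq> int q" for g a
  proof -
    have "\<pi> a dvd int (q ^ k) * g a" using that(2) unfolding pow_E by (auto dest: fun_cong[of _ _ a])
    then have "\<pi> a dvd g a" using cop prime_label that by blast
    moreover have "0 \<le> g a" "g a < \<pi> a" using that(1) by auto
    ultimately show ?thesis using zdvd_not_zless[of "g a" "\<pi> a"] by linarith
  qed
  show "u \<otimes>\<^bsub>U\<^esub> shift e v = v \<otimes>\<^bsub>U\<^esub> shift f u"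
  proof (intro ext)
    fix c t
    show "(u \<otimes>\<^bsub>U\<^esub> shift e v) c t = (v \<otimes>\<^bsub>U\<^esub> shift f u) c t"
    proof (cases "c \<in> C \<and> \<pi> (tgt c) = int q")
      case True
      then have "e (src c) = 0" "f (src c) = 0"
        using vanish ef e0 f0 src_in labels_distinct by metis+
      then show ?thesis by (simp add: shift_def add.commute)
    next
      case False
      let ?x = "(u \<otimes>\<^bsub>U\<^esub> shift e v) c t" and ?y = "(v \<otimes>\<^bsub>U\<^esub> shift f u) c t"
      have "v \<otimes>\<^bsub>U\<^esub> shift f u \<in> carrier U" using uv ef by (simp del: U_simps E_simps)
      then have "(inv\<^bsub>U\<^esub> (v \<otimes>\<^bsub>U\<^esub> shift f u)) c t = (- ?y) mod modulus c" by (simp only: inv_U)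
      moreover have "(int (q ^ k) * ((u \<otimes>\<^bsub>U\<^esub> shift e v) \<otimes>\<^bsub>U\<^esub> inv\<^bsub>U\<^esub> (v \<otimes>\<^bsub>U\<^esub> shift f u)) c t) mod modulus c = 0"
        using fun_cong[OF fun_cong[OF w0[unfolded pow_U]], of c t] by (simp only: U_simps(3))
      moreover have "(x \<otimes>\<^bsub>U\<^esub> y) c t = (x c t + y c t) mod modulus c" for x y by simp
      ultimately have "modulus c dvd int (q ^ k) * ((?x + (- ?y) mod modulus c) mod modulus c)"
        by (simp only: dvd_eq_mod_eq_0)
      moreover have "modulus c dvd z" if "modulus c dvd int (q ^ k) * z" for z
      proof (cases "c \<in> C")
        case True
        then have "modulus c = \<pi> (tgt c)" by (simp add: modulus_def)
        then show ?thesis using True False that by (metis cop prime_label tgt_in)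
      qed (simp add: modulus_def)
      ultimately have "modulus c dvd ?x + (- ?y) mod modulus c"
        by (metis dvd_mod_iff dvd_refl)
      then have "modulus c dvd ?x - ?y"
        by (simp add: dvd_eq_mod_eq_0 mod_simps algebra_simps)
      then have "?x mod modulus c = ?y mod modulus c" by (simp only: mod_eq_dvd_iff)
      then show ?thesis by simp
    qed
  qed
qed

end

subsection \<open>Transport along isomorphisms\<close>

lemma iso_image_group:
  assumes "group G" "inj_on h (carrier G)"
  shows "h \<in> iso G (image_group h G)"
proof -
  interpret group G by fact
  show ?thesis
    using assms(2) by (auto simp: iso_def hom_def image_group_def bij_betw_def)
qed

lemma group_image_group:
  assumes "group G" "inj_on h (carrier G)"
  shows "group (image_group h G)"
  using group.iso_imp_img_group[OF assms(1) iso_image_group[OF assms]] by (simp add: image_group_def)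

lemma comm_group_image_group:
  assumes "comm_group G" "inj_on h (carrier G)"
  shows "comm_group (image_group h G)"
  using comm_group.iso_imp_img_comm_group[OF assms(1) iso_image_group[OF comm_group.axioms(2)[OF assms(1)] assms(2)]]
  by (simp add: image_group_def)

locale brace_iso =
  fixes A :: "('a, 'b) monoid_scheme" and M :: "('a, 'c) monoid_scheme"
    and A' :: "('d, 'e) monoid_scheme" and M' :: "('d, 'f) monoid_scheme" and h :: "'a \<Rightarrow> 'd"
  assumes brace: "left_brace A M"
    and comm_group': "comm_group A'" and group': "group M'"
    and iso_add: "h \<in> iso A A'" and iso_mult: "h \<in> iso M M'"
begin

lemma groups: "group A" "group M" "group A'"
  using brace comm_group' by (simp_all add: left_brace_def comm_group.axioms)

lemma carrier_eq: "carrier A = carrier M"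
  using brace by (simp add: left_brace_def)

lemma bij: "bij_betw h (carrier M) (carrier M')"
  using iso_mult by (simp add: iso_def)

sublocale add: group_hom A A' h
  using groups iso_add by (simp add: group_hom_def group_hom_axioms_def iso_def)

sublocale mul: group_hom M M' h
  using groups group' iso_mult by (simp add: group_hom_def group_hom_axioms_def iso_def)

lemma carrier_eq': "carrier A' = carrier M'"
  using iso_add iso_mult carrier_eq by (metis iso_iff)

lemma left_brace_image: "left_brace A' M'"
  unfolding left_brace_def
proof (intro conjI ballI comm_group' group' carrier_eq')
  fix x y z assume "x \<in> carrier M'" "y \<in> carrier M'" "z \<in> carrier M'"
  then obtain a b c where abc: "a \<in> carrier M" "b \<in> carrier M" "c \<in> carrier M"
    and xyz: "x = h a" "y = h b" "z = h c"
    unfolding bij_betw_imp_surj_on[OF bij, symmetric] by blast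
  have "(a \<otimes>\<^bsub>M\<^esub> (b \<otimes>\<^bsub>A\<^esub> c)) \<otimes>\<^bsub>A\<^esub> a = (a \<otimes>\<^bsub>M\<^esub> b) \<otimes>\<^bsub>A\<^esub> (a \<otimes>\<^bsub>M\<^esub> c)"
    using brace abc by (simp add: left_brace_def)
  moreover have "b \<otimes>\<^bsub>A\<^esub> c \<in> carrier M" using abc carrier_eq add.G.m_closed by metis
  ultimately show "x \<otimes>\<^bsub>M'\<^esub> (y \<otimes>\<^bsub>A'\<^esub> z) \<otimes>\<^bsub>A'\<^esub> x = x \<otimes>\<^bsub>M'\<^esub> y \<otimes>\<^bsub>A'\<^esub> (x \<otimes>\<^bsub>M'\<^esub> z)"
    using abc unfolding xyz
    by (metis carrier_eq add.hom_mult mul.hom_mult mul.G.m_closed)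
qed

lemma brace_ideal_image:
  assumes "brace_ideal A M I"
  shows "brace_ideal A' M' (h ` I)"
proof -
  have sub: "subgroup I A" and norm: "I \<lhd> M"
    and lam: "\<And>b x. b \<in> carrier M \<Longrightarrow> x \<in> I \<Longrightarrow> brace_lambda A M b x \<in> I"
    using assms by (auto simp: brace_ideal_def brace_left_ideal_def)
  have "subgroup (h ` I) A'" using add.subgroup_img_is_subgroup[OF sub] .
  moreover have "h ` I \<lhd> M'" using iso_normal_subgroup[OF iso_mult groups(2) group' norm] .
  moreover have "brace_lambda A' M' y z \<in> h ` I" if yz: "y \<in> carrier M'" "z \<in> h ` I" for y z
  proof -
    obtain b x where bx: "b \<in> carrier M" "y = h b" "x \<in> I" "z = h x"
      using yz unfolding bij_betw_imp_surj_on[OF bij, symmetric] by blast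
    then have x: "x \<in> carrier M" using subgroup.mem_carrier[OF sub] carrier_eq by metis
    have "b \<otimes>\<^bsub>M\<^esub> x \<in> carrier A" "b \<in> carrier A" using bx x carrier_eq by auto
    then have "brace_lambda A' M' y z = h (brace_lambda A M b x)"
      using bx x by (simp add: brace_lambda_def)
    then show ?thesis using lam bx by simp
  qed
  ultimately show ?thesis by (simp add: brace_ideal_def brace_left_ideal_def)
qed

text \<open>This turns preimages into images, so that ideals and Sylow subgroups of the target can
  be pulled back with the image lemmas.\<close>

lemma brace_iso_inverse: "brace_iso A' M' A M (inv_into (carrier M) h)"
proof (rule brace_iso.intro)
  show "inv_into (carrier M) h \<in> iso A' A"
    using group.iso_set_sym[OF groups(1) iso_add] carrier_eq by simp
  show "inv_into (carrier M) h \<in> iso M' M"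
    using group.iso_set_sym[OF groups(2) iso_mult] .
qed (use left_brace_image brace in \<open>auto simp: left_brace_def\<close>)

lemma simple_left_brace_image:
  assumes "simple_left_brace A M"
  shows "simple_left_brace A' M'"
  unfolding simple_left_brace_def
proof (intro conjI allI impI left_brace_image)
  have img: "h ` carrier A = carrier A'" using iso_add by (simp add: iso_iff)
  have inj: "inj_on h (carrier A)" using iso_add by (simp add: iso_iff)
  have "carrier A \<noteq> {\<one>\<^bsub>A\<^esub>}" using assms by (simp add: simple_left_brace_def)
  then obtain x where "x \<in> carrier A" "x \<noteq> \<one>\<^bsub>A\<^esub>" by blast
  then have "h x \<noteq> \<one>\<^bsub>A'\<^esub>" "h x \<in> carrier A'" using inj by (auto simp flip: add.hom_one dest: inj_onD)
  then show "carrier A' \<noteq> {\<one>\<^bsub>A'\<^esub>}" by blast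
  fix I assume I: "brace_ideal A' M' I"
  let ?g = "inv_into (carrier M) h"
  have "brace_ideal A M (?g ` I)"
    using brace_iso.brace_ideal_image[OF brace_iso_inverse I] .
  then have "?g ` I = {\<one>\<^bsub>A\<^esub>} \<or> ?g ` I = carrier A"
    using assms by (simp add: simple_left_brace_def)
  moreover have "I \<subseteq> carrier M'"
    using I by (auto simp: brace_ideal_def normal_def dest: subgroup.mem_carrier)
  then have "h ` ?g ` I = I" using bij by (simp add: bij_betw_def image_inv_into_cancel)
  ultimately show "I = {\<one>\<^bsub>A'\<^esub>} \<or> I = carrier A'"
    using img by (metis add.hom_one image_empty image_insert)
qed

text \<open>A homomorphism carries derived subgroups to derived subgroups of the image, and
  \<open>h\<close> is onto.\<close>

lemma metabelian_image: "metabelian M \<Longrightarrow> metabelian M'"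
proof -
  assume "metabelian M"
  moreover have "derived M (carrier M) \<subseteq> carrier M"
    by (simp add: mul.G.derived_in_carrier)
  moreover have "h ` carrier M = carrier M'" using iso_mult by (simp add: iso_iff)
  ultimately show ?thesis
    using mul.derived_img[of "carrier M"] mul.derived_img[of "derived M (carrier M)"]
    by (simp add: metabelian_def)
qed

lemma all_sylow_abelian_image:
  assumes "all_sylow_abelian M"
  shows "all_sylow_abelian M'"
  unfolding all_sylow_abelian_def
proof (intro allI impI)
  fix q P assume P: "sylow_subgroup M' q P"
  interpret inv: brace_iso A' M' A M "inv_into (carrier M) h" by (rule brace_iso_inverse)
  let ?g = "inv_into (carrier M) h"
  have sub: "subgroup P M'" and card: "card P = q ^ multiplicity q (order M')"
    using P by (auto simp: sylow_subgroup_def)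
  have inj: "inj_on ?g (carrier M')" using inv.bij by (simp add: bij_betw_def)
  have "order M = order M'" using bij by (simp add: order_def bij_betw_same_card)
  moreover have "card (?g ` P) = card P"
    using inj subgroup.subset[OF sub] by (metis card_image inj_on_subset)
  ultimately have "sylow_subgroup M q (?g ` P)"
    using P card inv.mul.subgroup_img_is_subgroup[OF sub] by (simp add: sylow_subgroup_def)
  then have "comm_group (M\<lparr>carrier := ?g ` P\<rparr>)" using assms by (simp add: all_sylow_abelian_def)
  then have comm: "?g x \<otimes>\<^bsub>M\<^esub> ?g y = ?g y \<otimes>\<^bsub>M\<^esub> ?g x" if "x \<in> P" "y \<in> P" for x y
    using comm_groupE(4) that by fastforce
  have "x \<otimes>\<^bsub>M'\<^esub> y = y \<otimes>\<^bsub>M'\<^esub> x" if "x \<in> P" "y \<in> P" for x y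
  proof -
    have "x \<in> carrier M'" "y \<in> carrier M'" using that subgroup.mem_carrier[OF sub] by auto
    then show ?thesis
      using comm[OF that] by (intro inj_onD[OF inj]) auto
  qed
  then show "comm_group (M'\<lparr>carrier := P\<rparr>)"
    using mul.H.subgroup_imp_group[OF sub] by (intro group.group_comm_groupI) auto
qed

end

text \<open>The digraph brace consists of pairs of functions; being finite, it injects into the
  naturals and its structure is copied along the injection.\<close>

lemma simple_left_brace_on_nat:
  fixes A M :: "'a monoid"
  assumes simple: "simple_left_brace A M" and fin: "finite (carrier M)"
    and "metabelian M" "all_sylow_abelian M"
  shows "\<exists>(A' :: nat monoid) (M' :: nat monoid). simple_left_brace A' M' \<and>
    card (carrier M') = card (carrier M) \<and> metabelian M' \<and> all_sylow_abelian M'"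
proof -
  obtain h :: "'a \<Rightarrow> nat" where inj: "inj_on h (carrier M)"
    using finite_imp_inj_to_nat_seg[OF fin] by blast
  have brace: "left_brace A M" using simple by (simp add: simple_left_brace_def)
  then have A: "comm_group A" "inj_on h (carrier A)" and M: "group M"
    using inj by (auto simp: left_brace_def)
  interpret brace_iso A M "image_group h A" "image_group h M" h
    using brace comm_group_image_group[OF A] group_image_group[OF M inj]
      iso_image_group[OF comm_group.axioms(2)[OF A(1)] A(2)] iso_image_group[OF M inj]
    by (rule brace_iso.intro)
  show ?thesis
    using simple_left_brace_image[OF simple] metabelian_image[OF assms(3)]
      all_sylow_abelian_image[OF assms(4)] inj
    by (intro exI[of _ "image_group h A"] exI[of _ "image_group h M"])
       (simp add: image_group_carrier card_image)
qed

subsection \<open>A digraph with prescribed exponents\<close>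

theorem theorem1p1:
  fixes n :: nat and p :: "nat \<Rightarrow> nat"
  assumes "n > 1"
    and "\<forall>i<n. Factorial_Ring.prime (p i)"
    and "inj_on p {..<n}"
  shows "\<exists>l :: nat \<Rightarrow> nat. (\<forall>i<n. l i > 0) \<and>
    (\<forall>m :: nat \<Rightarrow> nat. (\<forall>i<n. m i \<ge> l i) \<longrightarrow>
      (\<exists>(A :: nat monoid) (M :: nat monoid).
          simple_left_brace A M \<and>
          card (carrier M) = (\<Prod>i<n. p i ^ m i) \<and>
          metabelian M \<and> all_sylow_abelian M))"
proof -
  \<comment> \<open>A single bound for all the primes, hence for every \<open>d i\<close> and
    \<open>k i\<close> below.\<close>
  define D where "D = (\<Sum>i<n. p i)"
  have D: "p i \<le> D" if "i < n" for i
    unfolding D_def using that by (intro member_le_sum) auto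
  have p2: "p i \<ge> 2" if "i < n" for i using assms(2) that prime_ge_2_nat by blast
  \<comment> \<open>Cyclic predecessor and successor modulo \<open>n\<close>; since n > 1, no index
    is its own predecessor, so adjacent levels carry different primes.\<close>
  define pr where "pr i = (if i = 0 then n - 1 else i - 1)" for i
  define su where "su i = (if Suc i = n then 0 else Suc i)" for i
  have pr: "pr i < n" "pr i \<noteq> i" if "i < n" for i
    using that assms(1) by (auto simp: pr_def)
  have su: "su i < n" "pr (su i) = i" if "i < n" for i
    using that assms(1) by (auto simp: pr_def su_def)
  have "\<exists>(A :: nat monoid) (M :: nat monoid). simple_left_brace A M \<and>
          card (carrier M) = (\<Prod>i<n. p i ^ m i) \<and> metabelian M \<and> all_sylow_abelian M"
    \<comment> \<open>As \<open>d i < D\<close>, this threshold gives \<open>r i\<close> at least 2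
      D, room for two blocks of \<open>D\<close> arcs into each level.\<close>
    if m: "\<forall>i<n. m i \<ge> 2 * D * D + 1" for m
  proof -
    define d where "d i = p (pr i) - 1" for i
    \<comment> \<open>Dividing \<open>m i - 1\<close> and adding 1 to the remainder keeps
      \<open>k i\<close> between 1 and \<open>d i\<close>, so no level is empty.\<close>
    define k where "k i = (m i - 1) mod d i + 1" for i
    define r where "r i = (m i - 1) div d i" for i
    have d: "d i > 0" "d i < D" if "i < n" for i
      using p2[OF pr(1)[OF that]] D[OF pr(1)[OF that]] by (auto simp: d_def)
    have mkr: "m i = k i + d i * r i" if "i < n" for i
    proof -
      have "m i \<ge> 1" using m[rule_format, OF that] by simp
      then show ?thesis
        using mult_div_mod_eq[of "d i" "m i - 1"] unfolding k_def r_def by linarith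
    qed
    have k: "0 < k i" "k i \<le> D" if "i < n" for i
    proof -
      have "(m i - 1) mod d i < d i" using d[OF that] by simp
      then show "0 < k i" "k i \<le> D" using d[OF that] unfolding k_def by linarith+
    qed
    have r: "2 * D \<le> r i" if "i < n" for i
    proof -
      have "2 * D * d i \<le> 2 * D * D" using d[OF that] by simp
      also have "\<dots> \<le> m i - 1" using m[rule_format, OF that] by simp
      finally show ?thesis using d[OF that] by (simp add: r_def less_eq_div_iff_mult_less_eq)
    qed
    define A where "A = (SIGMA i:{..<n}. {..<k i})"
    define C where "C = (SIGMA i:{..<n}. {..<r i})"
    \<comment> \<open>Outside its block an endpoint defaults to index 0, so surplus arcs join index
      0 to index 0 of consecutive levels and serve only to reach the exponent.\<close>
    define src where "src = (\<lambda>(i, s). (pr i, if s < k (pr i) then s else 0))"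
    define tgt where "tgt = (\<lambda>(i, s). (i, if D \<le> s \<and> s - D < k i then s - D else 0))"
    define \<pi> where "\<pi> = (\<lambda>a. if a \<in> A then int (p (fst a)) else 1)"
    define R where "R = {(src c, tgt c) |c. c \<in> C}"
    have src_in: "src c \<in> A" if "c \<in> C" for c
    proof -
      have i: "fst c < n" using that by (auto simp: C_def)
      then show ?thesis using pr(1)[OF i] k(1)[OF pr(1)[OF i]] by (cases c) (simp add: src_def A_def)
    qed
    have tgt_in: "tgt c \<in> A" if "c \<in> C" for c
    proof -
      have i: "fst c < n" using that by (auto simp: C_def)
      then show ?thesis using k(1)[OF i] by (cases c) (auto simp: tgt_def A_def)
    qed
    \<comment> \<open>The first block of arcs leads from every vertex to index 0 of the next level, the second from
      index 0 to every vertex of the next level.\<close>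
    have out: "((i, j), (su i, 0)) \<in> R" if "i < n" "j < k i" for i j
    proof -
      have "(su i, j) \<in> C" using that su(1)[OF that(1)] r[OF su(1)[OF that(1)]] k(2)[OF that(1)] by (simp add: C_def)
      moreover have "src (su i, j) = (i, j)" "tgt (su i, j) = (su i, 0)"
        using that su(2)[OF that(1)] k(2)[OF that(1)] by (simp_all add: src_def tgt_def)
      ultimately show ?thesis unfolding R_def by (intro CollectI exI[of _ "(su i, j)"]) auto
    qed
    have into: "((pr i, 0), (i, j)) \<in> R" if "i < n" "j < k i" for i j
    proof -
      have "(i, D + j) \<in> C" using that r[OF that(1)] k(2)[OF that(1)] by (simp add: C_def)
      moreover have "src (i, D + j) = (pr i, 0)" "tgt (i, D + j) = (i, j)"
        using that k(2)[OF pr(1)[OF that(1)]] by (simp_all add: src_def tgt_def)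
      ultimately show ?thesis unfolding R_def by (intro CollectI exI[of _ "(i, D + j)"]) auto
    qed
    have su0: "((i, 0), (su i, 0)) \<in> R" if "i < n" for i using out[OF that k(1)[OF that]] .
    have up: "((0, 0), (i, 0)) \<in> R\<^sup>*" if "i < n" for i
      using that
    proof (induction i)
      case (Suc i)
      then show ?case using su0[of i] by (auto simp: su_def intro: rtrancl_into_rtrancl)
    qed simp
    \<comment> \<open>The path keeps moving forward through level n - 1 and wraps around to level 0,
      hence induction on the number of remaining levels.\<close>
    have down: "((i, 0), (0, 0)) \<in> R\<^sup>*" if "i < n" for i
      using that
    proof (induction "n - i" arbitrary: i)
      case (Suc x)
      show ?case
      proof (cases "Suc i = n")
        case True
        then show ?thesis using su0[of i] by (auto simp: su_def)
      next
        case False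
        then have "((Suc i, 0), (0, 0)) \<in> R\<^sup>*" using Suc by auto
        then show ?thesis using su0[of i] False Suc.prems by (auto simp: su_def intro: converse_rtrancl_into_rtrancl)
      qed
    qed simp
    have conn: "(a, a') \<in> R\<^sup>+" if aa: "a \<in> A" "a' \<in> A" for a a'
    proof -
      obtain i j i' j' where a: "a = (i, j)" "i < n" "j < k i" and a': "a' = (i', j')" "i' < n" "j' < k i'"
        using aa by (auto simp: A_def)
      \<comment> \<open>Route: leave \<open>a\<close> for index 0 of the next level, travel along
        the zero indices to the level before that of \<open>a'\<close>, then enter
        \<open>a'\<close>.\<close>
      have "((su i, 0), (pr i', 0)) \<in> R\<^sup>*"
        using rtrancl_trans[OF down[OF su(1)[OF a(2)]] up[OF pr(1)[OF a'(2)]]] .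
      then show ?thesis using out[OF a(2,3)] into[OF a'(2,3)] unfolding a(1) a'(1)
        by (meson r_into_trancl rtrancl_trancl_trancl trancl_trans)
    qed
    interpret prime_digraph A C src tgt \<pi>
    proof
      show "finite A" "finite C" by (auto simp: A_def C_def)
      have "(0, 0) \<in> A" using assms(1) k[of 0] by (simp add: A_def)
      then show "A \<noteq> {}" by blast
      show "Factorial_Ring.prime (\<pi> a)" if "a \<in> A" for a
        using that assms(2) by (auto simp: \<pi>_def A_def)
      show "\<pi> a = 1" if "a \<notin> A" for a using that by (simp add: \<pi>_def)
      show "src c \<in> A" "tgt c \<in> A" if "c \<in> C" for c using that src_in tgt_in by auto
      show "\<pi> (src c) \<noteq> \<pi> (tgt c)" if "c \<in> C" for c
      proof -
        have "fst c < n" using that by (auto simp: C_def)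
        then have "p (pr (fst c)) \<noteq> p (fst c)" using pr[of "fst c"] assms(3) by (auto dest: inj_onD)
        then show ?thesis using src_in[OF that] tgt_in[OF that]
          by (simp add: \<pi>_def) (cases c, simp add: src_def tgt_def)
      qed
      show "(a, a') \<in> {(src c, tgt c) |c. c \<in> C}\<^sup>+" if "a \<in> A" "a' \<in> A" for a a'
        using conn[OF that] by (simp add: R_def)
    qed
    have "(\<Prod>a\<in>A. nat (\<pi> a)) = (\<Prod>a\<in>A. p (fst a))"
      by (intro prod.cong) (auto simp: \<pi>_def)
    also have "\<dots> = (\<Prod>i<n. \<Prod>j<k i. p i)"
      unfolding A_def by (subst prod.Sigma) (auto intro: prod.cong)
    finally have cardA: "(\<Prod>a\<in>A. nat (\<pi> a)) = (\<Prod>i<n. p i ^ k i)" by simp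
    \<comment> \<open>Each arc into level \<open>i\<close> starts at label \<open>p (pr i)\<close>,
      so it contributes \<open>p i\<close> to the power \<open>d i\<close>; there are
      \<open>r i\<close> such arcs.\<close>
    have "(\<Prod>c\<in>C. nat (\<pi> (tgt c)) ^ (nat (\<pi> (src c)) - 1)) = (\<Prod>c\<in>C. p (fst c) ^ d (fst c))"
    proof (rule prod.cong)
      fix c assume "c \<in> C"
      then have "\<pi> (src c) = int (p (pr (fst c)))" "\<pi> (tgt c) = int (p (fst c))"
        using src_in tgt_in by (simp_all add: \<pi>_def) (cases c, simp add: src_def tgt_def)+
      then show "nat (\<pi> (tgt c)) ^ (nat (\<pi> (src c)) - 1) = p (fst c) ^ d (fst c)" by (simp add: d_def)
    qed simp
    also have "\<dots> = (\<Prod>i<n. \<Prod>j<r i. p i ^ d i)"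
      unfolding C_def by (subst prod.Sigma) (auto intro: prod.cong)
    finally have cardC: "(\<Prod>c\<in>C. nat (\<pi> (tgt c)) ^ (nat (\<pi> (src c)) - 1)) = (\<Prod>i<n. p i ^ (d i * r i))"
      by (simp add: power_mult)
    have card: "card (carrier mult_group) = (\<Prod>i<n. p i ^ m i)"
      unfolding card_mult_group cardA cardC prod.distrib[symmetric]
      by (intro prod.cong) (auto simp: mkr simp flip: power_add)
    have "(\<Prod>i<n. p i ^ m i) \<noteq> 0" using assms(2) by (auto simp: prime_gt_0_nat)
    then have "finite (carrier mult_group)" using card by (metis card.infinite)
    from simple_left_brace_on_nat[OF digraph_brace_simple this metabelian_mult_group digraph_brace_sylow]
    show ?thesis unfolding card .
  qed
  \<comment> \<open>One bound serves all indices; through \<open>D\<close> it depends only on the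
    primes.\<close>
  then show ?thesis by (intro exI[of _ "\<lambda>_. 2 * D * D + 1"]) auto
qed

end
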